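(* The $W$-Brownian bridge $B_{W,0}$ on $[0,1]$ is a Gaussian Markov random field; that is, for every (relatively) open set $S\subset[0,1]$, the $\sigma$-algebras $\mathcal{F}^{B_{W,0}}_+(\overline{S})$ and $\mathcal{F}^{B_{W,0}}_+([0,1]\setminus S)$ are conditionally independent given $\mathcal{F}^{B_{W,0}}_+(\partial S)$.
   Context: $W:\mathbb{R}\to\mathbb{R}$ is strictly increasing and càdlàg (right-continuous with left limits), with $W(x+1)-W(x)=W(1)-W(0)$ for all $x$, continuous at $0$ and $W(0)=0$; it may otherwise have jumps. The $W$-Brownian bridge $B_{W,0}=(B_{W,0}(t))_{t\in[0,1]}$ is the centered Gaussian process with covariance function $$\varrho_{W,0}(t,s)=W(t\wedge s)-\frac{W(t)W(s)}{W(1)},\qquad s,t\in[0,1].$$ For a Borel set $S\subset[0,1]$, $$\mathcal{F}^{B_{W,0}}_+(S)=\bigcap_{\epsilon>0}\sigma(B_{W,0}(s):s\in S_\epsilon),\qquad S_\epsilon=\{t\in[0,1]:d(t,S)<\epsilon\},$$ where $d$ is the usual distance (and $S_\epsilon=\emptyset$ if $S=\emptyset$). $\overline{S}$ and $\partial S$ are the closure and boundary of $S$ relative to $[0,1]$. All $\sigma$-algebras are understood up to null sets. *)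

theory Defs
  imports "HOL-Probability.Probability"
begin

definition cadlag :: "(real \<Rightarrow> real) \<Rightarrow> bool" where
  "cadlag f \<longleftrightarrow>
     (\<forall>x. continuous (at_right x) f \<and> (\<exists>l. (f \<longlongrightarrow> l) (at_left x)))"

text \<open>Constants count as (degenerate) Gaussian variables.\<close>

definition gaussian_var :: "'a measure \<Rightarrow> ('a \<Rightarrow> real) \<Rightarrow> bool" where
  "gaussian_var M X \<longleftrightarrow> X \<in> borel_measurable M \<and>
     ((\<exists>\<mu> \<sigma>. 0 < \<sigma> \<and> distributed M lborel X (normal_density \<mu> \<sigma>)) \<or>
      (\<exists>\<mu>. AE \<omega> in M. X \<omega> = \<mu>))"

definition gaussian_process ::
    "'a measure \<Rightarrow> 't set \<Rightarrow> ('t \<Rightarrow> 'a \<Rightarrow> real) \<Rightarrow> bool" where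
  "gaussian_process M T X \<longleftrightarrow>
     (\<forall>I (c :: 't \<Rightarrow> real). finite I \<and> I \<subseteq> T \<longrightarrow>
        gaussian_var M (\<lambda>\<omega>. \<Sum>t\<in>I. c t * X t \<omega>))"

definition covariance :: "'a measure \<Rightarrow> ('a \<Rightarrow> real) \<Rightarrow> ('a \<Rightarrow> real) \<Rightarrow> real" where
  "covariance M X Y =
     (\<integral>\<omega>. (X \<omega> - (\<integral>\<omega>'. X \<omega>' \<partial>M)) * (Y \<omega> - (\<integral>\<omega>'. Y \<omega>' \<partial>M)) \<partial>M)"

definition W_brownian_bridge ::
    "'a measure \<Rightarrow> (real \<Rightarrow> real) \<Rightarrow> (real \<Rightarrow> 'a \<Rightarrow> real) \<Rightarrow> bool" where
  "W_brownian_bridge M W B \<longleftrightarrow>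
     gaussian_process M {0..1} B \<and>
     (\<forall>t\<in>{0..1}. (\<integral>\<omega>. B t \<omega> \<partial>M) = 0) \<and>
     (\<forall>t\<in>{0..1}. \<forall>s\<in>{0..1}.
        covariance M (B t) (B s) = W (min t s) - W t * W s / W 1)"

text \<open>
  The \<open>\<sigma>\<close>-algebra generated by \<open>X s\<close>, \<open>s \<in> S\<close>, is augmented by the null sets
  of \<open>M\<close>.  A family of generators is used instead of a supremum of vimage algebras, so that
  the carrier is \<open>space M\<close> also for empty \<open>S\<close>.
\<close>

definition sigma_of_process ::
    "'a measure \<Rightarrow> ('t \<Rightarrow> 'a \<Rightarrow> real) \<Rightarrow> 't set \<Rightarrow> 'a measure" where
  "sigma_of_process M X S = sigma (space M)
     ({X s -` A \<inter> space M | s A. s \<in> S \<and> A \<in> sets borel} \<union> null_sets M)"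

text \<open>The explicit case distinction is needed because \<^term>\<open>infdist t {} = 0\<close>.\<close>

definition rel_neighbourhood :: "'t::metric_space set \<Rightarrow> 't set \<Rightarrow> real \<Rightarrow> 't set" where
  "rel_neighbourhood T S \<epsilon> = (if S = {} then {} else {t \<in> T. infdist t S < \<epsilon>})"

text \<open>
  The intersection below is itself a \<open>\<sigma>\<close>-algebra on \<open>space M\<close>; the outer
  \<^const>\<open>sigma\<close> only packages it as a measure space.
\<close>

definition germ_field ::
    "'a measure \<Rightarrow> 't::metric_space set \<Rightarrow> ('t \<Rightarrow> 'a \<Rightarrow> real) \<Rightarrow> 't set \<Rightarrow> 'a measure" where
  "germ_field M T X S = sigma (space M)
     (\<Inter>\<epsilon>\<in>{0<..}. sets (sigma_of_process M X (rel_neighbourhood T S \<epsilon>)))"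

definition cond_indep ::
    "'a measure \<Rightarrow> 'a measure \<Rightarrow> 'a measure \<Rightarrow> 'a measure \<Rightarrow> bool" where
  "cond_indep M F G H \<longleftrightarrow>
     subalgebra M F \<and> subalgebra M G \<and> subalgebra M H \<and>
     (\<forall>a\<in>sets F. \<forall>b\<in>sets G. AE \<omega> in M.
        real_cond_exp M H (indicator (a \<inter> b)) \<omega> =
        real_cond_exp M H (indicator a) \<omega> * real_cond_exp M H (indicator b) \<omega>)"

definition markov_random_field ::
    "'a measure \<Rightarrow> 't::metric_space set \<Rightarrow> ('t \<Rightarrow> 'a \<Rightarrow> real) \<Rightarrow> bool" where
  "markov_random_field M T X \<longleftrightarrow>
     (\<forall>S. openin (top_of_set T) S \<longrightarrow>
        cond_indep M
          (germ_field M T X (top_of_set T closure_of S))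
          (germ_field M T X (T - S))
          (germ_field M T X (top_of_set T frontier_of S)))"

definition gaussian_markov_random_field ::
    "'a measure \<Rightarrow> 't::metric_space set \<Rightarrow> ('t \<Rightarrow> 'a \<Rightarrow> real) \<Rightarrow> bool" where
  "gaussian_markov_random_field M T X \<longleftrightarrow>
     gaussian_process M T X \<and> markov_random_field M T X"

end

theory Submission
  imports Defs
begin

text \<open>
  For \<open>u \<le> s\<close> the covariance of \<open>B s\<close> and \<open>B u\<close> is \<open>W u (1 - W s / W 1)\<close>, and for \<open>s \<le> u\<close> it is
  \<open>W s (1 - W u / W 1)\<close>.  Both expressions are affine in \<open>W s\<close>.  So if \<open>p < s < q\<close>, the linear
  combination of \<open>B p\<close> and \<open>B q\<close> that interpolates in the scale \<open>W\<close> has the same covariance with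
  \<open>B u\<close> as \<open>B s\<close> itself, for every \<open>u\<close> outside of \<open>(p, q)\<close> (lemma
  \<open>W_brownian_bridge_regression\<close>).

  If a closed set \<open>K\<close> containing \<open>0\<close> and \<open>1\<close> separates \<open>A\<close> from \<open>C\<close>, each \<open>B s\<close> with \<open>s \<in> A\<close> is
  thus a linear combination of variables \<open>B k\<close>, \<open>k \<in> K\<close>, plus a residual that is orthogonal to
  the process on \<open>C \<union> K\<close>.  In a Gaussian space orthogonality is independence
  (\<open>gaussian_orthogonal_indep\<close>), and so the process on \<open>A\<close> and the process on \<open>C\<close> are conditionally
  independent given the process on \<open>K\<close> (\<open>gaussian_separation\<close>).

  For an open set \<open>S\<close> this applies to the \<open>\<epsilon>\<close>-neighbourhoods of its closure and of its complement,
  with the closed \<open>\<epsilon>\<close>-neighbourhood of the boundary as \<open>K\<close>; by connectedness it separates them.  The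
  endpoints can be adjoined to \<open>K\<close> because \<open>B 0\<close> and \<open>B 1\<close> vanish almost surely.  Finally
  \<open>\<epsilon>\<close> tends to \<open>0\<close>.  By definition, the germ field of the boundary is the intersection of the
  \<open>\<sigma>\<close>-algebras of its neighbourhoods, so all that is needed is the convergence of conditional
  expectations along a decreasing sequence of \<open>\<sigma>\<close>-algebras (\<open>cond_indep_decreasing\<close>).  The germ
  fields themselves never have to be described.

  The independence of orthogonal Gaussian families is derived from the uniqueness theorem for
  characteristic functions in one variable, which is iterated over finitely many constraints
  (\<open>set_integral_zero_if_fourier_zero\<close>).
\<close>

section \<open>Densities with vanishing Fourier transform\<close>

lemma set_integral_zero_sigma_sets:
  fixes \<phi> :: "'a \<Rightarrow> 'b::{banach, second_countable_topology}"
  assumes int: "integrable M \<phi>"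
    and P: "Int_stable P" "P \<subseteq> sets M"
    and total: "(\<integral>x. \<phi> x \<partial>M) = 0"
    and basic: "\<And>U. U \<in> P \<Longrightarrow> (LINT x:U|M. \<phi> x) = 0"
    and A: "A \<in> sigma_sets (space M) P"
  shows "(LINT x:A|M. \<phi> x) = 0"
proof -
  have sub: "sigma_sets (space M) P \<subseteq> sets M"
    by (rule sets.sigma_sets_subset[OF P(2)])
  have si: "set_integrable M U \<phi>" if "U \<in> sets M" for U
    using integrable_mult_indicator[OF that int] by (simp add: set_integrable_def)
  have "P \<subseteq> Pow (space M)"
    using P(2) sets.space_closed by blast
  from P(1) this A show ?thesis
  proof (induction rule: sigma_sets_induct_disjoint)
    case (basic U)
    then show ?case by (rule assms(5))
  next
    case empty
    show ?case by (simp add: set_lebesgue_integral_def)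
  next
    case (compl U)
    then have U: "U \<in> sets M" using sub by blast
    have "(LINT x:(space M - U)|M. \<phi> x) = (\<integral>x. \<phi> x - indicator U x *\<^sub>R \<phi> x \<partial>M)"
      unfolding set_lebesgue_integral_def
      by (intro Bochner_Integration.integral_cong) (auto simp: indicator_def)
    also have "\<dots> = (\<integral>x. \<phi> x \<partial>M) - (LINT x:U|M. \<phi> x)"
      unfolding set_lebesgue_integral_def
      using si[OF U] int by (intro Bochner_Integration.integral_diff) (auto simp: set_integrable_def)
    finally show ?case using compl total by simp
  next
    case (union U)
    then have U: "U i \<in> sets M" for i using sub by blast
    have "(LINT x:(\<Union>i. U i)|M. \<phi> x) = (\<Sum>i. (LINT x:(U i)|M. \<phi> x))"
      using union(1) U by (intro lebesgue_integral_countable_add si)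
        (auto simp: disjoint_family_on_def)
    then show ?case using union by simp
  qed
qed

text \<open>
  Up to the common normalising constant, \<open>\<psi>\<^sup>+\<close> and \<open>\<psi>\<^sup>-\<close> are probability densities (the case
  \<open>t = 0\<close> says that their masses agree), and the hypothesis says that the laws of \<open>X\<close> under them have
  the same characteristic function.  Levy's uniqueness theorem identifies the two laws.
\<close>

lemma real_set_integral_vimage_zero:
  fixes \<psi> X :: "'a \<Rightarrow> real"
  assumes int [measurable]: "integrable M \<psi>"
    and X [measurable]: "X \<in> borel_measurable M"
    and fourier: "\<And>t. (\<integral>x. \<psi> x *\<^sub>R iexp (t * X x) \<partial>M) = 0"
    and A [measurable]: "A \<in> sets borel"
  shows "(LINT x:(X -` A \<inter> space M)|M. \<psi> x) = 0"
proof -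
  define p where "p = (\<lambda>x. max (\<psi> x) 0)"
  define m where "m = (\<lambda>x. max (- \<psi> x) 0)"
  define c where "c = (\<integral>x. p x \<partial>M)"
  have [measurable]: "p \<in> borel_measurable M" "m \<in> borel_measurable M"
    unfolding p_def m_def by measurable
  have pi: "integrable M p" and mi: "integrable M m"
    unfolding p_def m_def using int by (auto intro!: integrable_max)
  have psi: "\<psi> x = p x - m x" for x by (auto simp: p_def m_def)
  have nn: "0 \<le> p x" "0 \<le> m x" for x by (auto simp: p_def m_def)
  have "(\<integral>x. complex_of_real (\<psi> x) \<partial>M) = 0"
    using fourier[of 0] by (simp add: scaleR_conv_of_real)
  then have "(\<integral>x. \<psi> x \<partial>M) = 0" by simp
  then have mc: "(\<integral>x. m x \<partial>M) = c"
    unfolding c_def psi using pi mi by simp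
  have c0: "0 \<le> c" unfolding c_def by (simp add: nn)
  have ii: "integrable M (\<lambda>x. f x *\<^sub>R iexp (t * X x))" if "integrable M f" for t and f :: "'a \<Rightarrow> real"
    using that
    by (rule Bochner_Integration.integrable_bound)
       (use that in \<open>auto intro!: AE_I2 borel_measurable_scaleR borel_measurable_integrable\<close>)
  show ?thesis
  proof (cases "c = 0")
    case True
    have "AE x in M. p x = 0" "AE x in M. m x = 0"
      using True mc nn pi mi integral_nonneg_eq_0_iff_AE[of M p] integral_nonneg_eq_0_iff_AE[of M m]
      by (auto simp: c_def)
    then have "AE x in M. \<psi> x = 0" by eventually_elim (simp add: psi)
    then show ?thesis
      unfolding set_lebesgue_integral_def by (intro integral_eq_zero_AE) auto
  next
    case False
    with c0 have c: "0 < c" by simp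
    define D where "D = (\<lambda>f. distr (density M (\<lambda>x. ennreal (f x / c))) borel X)"
    have D: "real_distribution (D f)" "char (D f) t = (\<integral>x. f x *\<^sub>R iexp (t * X x) \<partial>M) /\<^sub>R c"
        "measure (D f) A = (LINT x:(X -` A \<inter> space M)|M. f x) / c"
      if f: "integrable M f" "\<And>x. 0 \<le> f x" "(\<integral>x. f x \<partial>M) = c" for f t
    proof -
      have fm [measurable]: "f \<in> borel_measurable M" using f(1) by simp
      have "(\<integral>\<^sup>+x. ennreal (f x / c) \<partial>M) = ennreal (\<integral>x. f x / c \<partial>M)"
        using f c by (intro nn_integral_eq_integral) auto
      also have "\<dots> = 1" using f c by simp
      finally have "prob_space (density M (\<lambda>x. ennreal (f x / c)))"
        by (intro prob_spaceI) (simp add: emeasure_density cong: nn_integral_cong)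
      then interpret d: prob_space "density M (\<lambda>x. ennreal (f x / c))" .
      have rd: "prob_space (D f)" unfolding D_def by (rule d.prob_space_distr) simp
      then show "real_distribution (D f)"
        by (auto simp: real_distribution_def real_distribution_axioms_def D_def)
      have "char (D f) t = (\<integral>x. (f x / c) *\<^sub>R iexp (t * X x) \<partial>M)"
        unfolding char_def D_def
        apply (subst integral_distr)
          apply simp
         apply simp
        apply (subst integral_density)
        using f c apply auto
        done
      also have "\<dots> = (\<integral>x. (f x *\<^sub>R iexp (t * X x)) /\<^sub>R c \<partial>M)"
        by (intro Bochner_Integration.integral_cong) (auto simp: divide_inverse mult.commute)
      finally show "char (D f) t = (\<integral>x. f x *\<^sub>R iexp (t * X x) \<partial>M) /\<^sub>R c"
        by (subst (asm) integral_scaleR_right) (simp_all add: ii f)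
      have "measure (D f) A = (\<integral>y. indicator A y \<partial>D f)"
        using A by (simp add: D_def)
      also have "\<dots> = (\<integral>x. (f x / c) *\<^sub>R indicator A (X x) \<partial>M)"
        unfolding D_def
        apply (subst integral_distr)
          apply simp
         apply simp
        apply (subst integral_density)
        using f c apply auto
        done
      also have "\<dots> = (\<integral>x. (indicator (X -` A \<inter> space M) x *\<^sub>R f x) / c \<partial>M)"
        by (intro Bochner_Integration.integral_cong) (auto simp: indicator_def)
      finally show "measure (D f) A = (LINT x:(X -` A \<inter> space M)|M. f x) / c"
        by (simp add: set_lebesgue_integral_def)
    qed
    note Dp = D[OF pi nn(1) c_def[symmetric]] and Dm = D[OF mi nn(2) mc]
    have "(\<integral>x. p x *\<^sub>R iexp (t * X x) \<partial>M) - (\<integral>x. m x *\<^sub>R iexp (t * X x) \<partial>M)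
        = (\<integral>x. \<psi> x *\<^sub>R iexp (t * X x) \<partial>M)" for t
      by (subst Bochner_Integration.integral_diff[symmetric])
        (use ii[OF pi, of t] ii[OF mi, of t] in \<open>simp_all add: psi scaleR_left_diff_distrib\<close>)
    then have "(\<integral>x. p x *\<^sub>R iexp (t * X x) \<partial>M) = (\<integral>x. m x *\<^sub>R iexp (t * X x) \<partial>M)" for t
      using fourier[of t] by (subst eq_iff_diff_eq_0) (rule trans)
    then have "char (D p) = char (D m)"
      by (intro ext) (simp only: Dp(2) Dm(2))
    then have "D p = D m" by (intro Levy_uniqueness Dp Dm)
    then have eq: "(LINT x:(X -` A \<inter> space M)|M. p x) = (LINT x:(X -` A \<inter> space M)|M. m x)"
      using Dp(3) Dm(3) c by simp
    have "(LINT x:(X -` A \<inter> space M)|M. \<psi> x)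
        = (LINT x:(X -` A \<inter> space M)|M. p x) - (LINT x:(X -` A \<inter> space M)|M. m x)"
      unfolding psi
      by (intro set_integral_diff; unfold set_integrable_def; intro integrable_mult_indicator pi mi; measurable)
    with eq show ?thesis by simp
  qed
qed

text \<open>
  The real and the imaginary part of \<open>\<phi>\<close> can be treated separately because conjugating the
  hypothesis at \<open>-t\<close> gives the hypothesis at \<open>t\<close> for the conjugate of \<open>\<phi>\<close>.
\<close>

lemma set_integral_vimage_zero:
  fixes \<phi> :: "'a \<Rightarrow> complex" and X :: "'a \<Rightarrow> real"
  assumes int [measurable]: "integrable M \<phi>"
    and X [measurable]: "X \<in> borel_measurable M"
    and fourier: "\<And>t. (\<integral>x. \<phi> x * iexp (t * X x) \<partial>M) = 0"
    and A [measurable]: "A \<in> sets borel"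
  shows "(LINT x:(X -` A \<inter> space M)|M. \<phi> x) = 0"
proof -
  let ?U = "X -` A \<inter> space M"
  have ii: "integrable M (\<lambda>x. \<phi> x * iexp (t * X x))" for t
    using int
    by (rule Bochner_Integration.integrable_bound) (use int in \<open>auto simp: norm_mult\<close>)
  have cnj0: "(\<integral>x. cnj (\<phi> x) * iexp (t * X x) \<partial>M) = 0" for t
  proof -
    have "cnj (\<phi> x) * iexp (t * X x) = cnj (\<phi> x * iexp ((- t) * X x))" for x
      by (simp add: exp_cnj)
    then have "(\<integral>x. cnj (\<phi> x) * iexp (t * X x) \<partial>M) = (\<integral>x. cnj (\<phi> x * iexp ((- t) * X x)) \<partial>M)"
      by (simp only:)
    also have "\<dots> = cnj (\<integral>x. \<phi> x * iexp ((- t) * X x) \<partial>M)" by (rule Bochner_Integration.integral_cnj)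
    finally show ?thesis using fourier[of "- t"] by (simp only: complex_cnj_zero)
  qed
  have ci: "integrable M (\<lambda>x. cnj (\<phi> x) * iexp (t * X x))" for t
    using Bochner_Integration.integrable_cnj[OF ii[of "- t"]] by (simp add: exp_cnj)
  have re: "(\<integral>x. Re (\<phi> x) *\<^sub>R iexp (t * X x) \<partial>M) = 0" for t
  proof -
    have "Re (\<phi> x) *\<^sub>R iexp (t * X x)
        = (\<phi> x * iexp (t * X x) + cnj (\<phi> x) * iexp (t * X x)) / 2" for x
      by (simp add: distrib_right[symmetric] complex_add_cnj scaleR_conv_of_real)
    then have "(\<integral>x. Re (\<phi> x) *\<^sub>R iexp (t * X x) \<partial>M)
        = (\<integral>x. (\<phi> x * iexp (t * X x) + cnj (\<phi> x) * iexp (t * X x)) / 2 \<partial>M)"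
      by (simp only:)
    also have "\<dots> = ((\<integral>x. \<phi> x * iexp (t * X x) \<partial>M) + (\<integral>x. cnj (\<phi> x) * iexp (t * X x) \<partial>M)) / 2"
      by (simp only: integral_divide_zero Bochner_Integration.integral_add[OF ii ci])
    finally show ?thesis by (simp only: fourier cnj0) simp
  qed
  have im: "(\<integral>x. Im (\<phi> x) *\<^sub>R iexp (t * X x) \<partial>M) = 0" for t
  proof -
    have "Im (\<phi> x) *\<^sub>R iexp (t * X x)
        = (\<phi> x * iexp (t * X x) - cnj (\<phi> x) * iexp (t * X x)) / (2 * \<i>)" for x
      by (simp only: left_diff_distrib[symmetric] complex_diff_cnj scaleR_conv_of_real) (simp add: field_simps)
    then have "(\<integral>x. Im (\<phi> x) *\<^sub>R iexp (t * X x) \<partial>M)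
        = (\<integral>x. (\<phi> x * iexp (t * X x) - cnj (\<phi> x) * iexp (t * X x)) / (2 * \<i>) \<partial>M)"
      by (simp only:)
    also have "\<dots> = ((\<integral>x. \<phi> x * iexp (t * X x) \<partial>M) - (\<integral>x. cnj (\<phi> x) * iexp (t * X x) \<partial>M)) / (2 * \<i>)"
      by (simp only: integral_divide_zero Bochner_Integration.integral_diff[OF ii ci])
    finally show ?thesis by (simp only: fourier cnj0) simp
  qed
  have si: "integrable M (\<lambda>x. indicator ?U x *\<^sub>R \<phi> x)"
    using int by (intro integrable_mult_indicator) auto
  have "(LINT x:?U|M. Re (\<phi> x)) = 0" "(LINT x:?U|M. Im (\<phi> x)) = 0"
    using int re im by (auto intro!: real_set_integral_vimage_zero)
  moreover have "Re (LINT x:?U|M. \<phi> x) = (LINT x:?U|M. Re (\<phi> x))"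
      "Im (LINT x:?U|M. \<phi> x) = (LINT x:?U|M. Im (\<phi> x))"
    unfolding set_lebesgue_integral_def using si
    by (simp_all add: integral_Re[symmetric] integral_Im[symmetric] del: integral_Re integral_Im)
  ultimately show ?thesis by (simp add: complex_eq_iff)
qed


text \<open>
  The finite intersections of sets \<open>X -` A\<close> with \<open>X \<in> L\<close>.  The inductive form adds one
  constraint at a time, which is how the one-dimensional uniqueness theorem is iterated.
\<close>

inductive_set cylinder_sets :: "'a measure \<Rightarrow> ('a \<Rightarrow> real) set \<Rightarrow> 'a set set"
  for M L where
  whole: "space M \<in> cylinder_sets M L"
| slice: "U \<in> cylinder_sets M L \<Longrightarrow> X \<in> L \<Longrightarrow> A \<in> sets borel \<Longrightarrow> X -` A \<inter> U \<in> cylinder_sets M L"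

lemma cylinder_sets_measurable:
  assumes "U \<in> cylinder_sets M L" "L \<subseteq> borel_measurable M"
  shows "U \<in> sets M"
  using assms(1)
proof induction
  case (slice U X A)
  then have "X -` A \<inter> space M \<in> sets M"
    using assms(2) by (intro measurable_sets) auto
  moreover have "X -` A \<inter> U = (X -` A \<inter> space M) \<inter> U"
    using slice.IH sets.sets_into_space by blast
  ultimately show ?case using slice.IH by auto
qed simp

lemma cylinder_sets_Int:
  assumes U: "U \<in> cylinder_sets M L" and V: "V \<in> cylinder_sets M L"
    and L: "L \<subseteq> borel_measurable M"
  shows "U \<inter> V \<in> cylinder_sets M L"
  using U
proof induction
  case whole
  have "space M \<inter> V = V"
    using sets.sets_into_space[OF cylinder_sets_measurable[OF V L]] by blast
  with V show ?case by simp
next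
  case (slice U X A)
  then show ?case by (simp add: Int_assoc cylinder_sets.slice)
qed

definition linear_family :: "('a \<Rightarrow> real) set \<Rightarrow> bool" where
  "linear_family L \<longleftrightarrow> (\<lambda>_. 0) \<in> L \<and> (\<forall>X\<in>L. \<forall>Y\<in>L. \<forall>t. (\<lambda>x. X x + t * Y x) \<in> L)"

lemma linear_family_zero: "linear_family L \<Longrightarrow> (\<lambda>_. 0) \<in> L"
  by (simp add: linear_family_def)

lemma linear_family_add:
  "linear_family L \<Longrightarrow> X \<in> L \<Longrightarrow> Y \<in> L \<Longrightarrow> (\<lambda>x. X x + t * Y x) \<in> L"
  by (simp add: linear_family_def)

lemma sets_sigma_of_process:
  "sets (sigma_of_process M X S) =
    sigma_sets (space M) ({X s -` A \<inter> space M | s A. s \<in> S \<and> A \<in> sets borel} \<union> null_sets M)"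
  unfolding sigma_of_process_def
  by (intro sets_measure_of) (auto dest!: null_setsD2 dest: sets.sets_into_space)

lemma space_sigma_of_process [simp]: "space (sigma_of_process M X S) = space M"
  unfolding sigma_of_process_def by (rule space_measure_of_conv)

text \<open>
  A substitute for the uniqueness theorem for characteristic functions in several variables: a
  complex density whose Fourier transform vanishes on a linear family vanishes on the
  \<open>\<sigma>\<close>-algebra that the family generates.  Multiplying the density by the indicator of a
  constraint \<open>X \<in> A\<close> preserves the hypothesis, by the one-dimensional case applied to
  \<open>\<phi> \<cdot> iexp Z\<close>; hence it holds for all cylinder sets, and these are closed under intersection.
\<close>

lemma set_integral_zero_if_fourier_zero:
  fixes \<phi> :: "'a \<Rightarrow> complex"
  assumes int [measurable]: "integrable M \<phi>"
    and lin: "linear_family L" and L: "L \<subseteq> borel_measurable M"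
    and fourier: "\<And>Z. Z \<in> L \<Longrightarrow> (\<integral>x. \<phi> x * iexp (Z x) \<partial>M) = 0"
    and A: "A \<in> sets (sigma_of_process M (\<lambda>X. X) L)"
  shows "(LINT x:A|M. \<phi> x) = 0"
proof -
  have bdd: "integrable M (\<lambda>x. indicator U x *\<^sub>R \<phi> x * iexp (Z x))"
    if "U \<in> sets M" "Z \<in> L" for U Z
  proof (rule Bochner_Integration.integrable_bound[OF int])
    have [measurable]: "Z \<in> borel_measurable M" using that L by auto
    show "(\<lambda>x. indicator U x *\<^sub>R \<phi> x * iexp (Z x)) \<in> borel_measurable M"
      using that by measurable
  qed (rule AE_I2, simp add: norm_mult split: split_indicator)
  have cyl: "\<forall>Z\<in>L. (\<integral>x. indicator U x *\<^sub>R \<phi> x * iexp (Z x) \<partial>M) = 0"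
    if "U \<in> cylinder_sets M L" for U
    using that
  proof induction
    case whole
    have "(\<integral>x. indicator (space M) x *\<^sub>R \<phi> x * iexp (Z x) \<partial>M) = (\<integral>x. \<phi> x * iexp (Z x) \<partial>M)" for Z
      by (intro Bochner_Integration.integral_cong) auto
    with fourier show ?case by auto
  next
    case (slice U X A)
    have U: "U \<in> sets M" using cylinder_sets_measurable[OF slice.hyps(1) L] .
    have Xm: "X \<in> borel_measurable M" using slice.hyps L by auto
    show ?case
    proof
      fix Z assume Z: "Z \<in> L"
      have "(\<integral>x. (indicator U x *\<^sub>R \<phi> x * iexp (Z x)) * iexp (t * X x) \<partial>M) = 0" for t
      proof -
        have "(\<lambda>x. Z x + t * X x) \<in> L"
          using lin Z slice.hyps by (auto simp: linear_family_def)
        then have "(\<integral>x. indicator U x *\<^sub>R \<phi> x * iexp (Z x + t * X x) \<partial>M) = 0"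
          by (rule bspec[OF slice.IH])
        then show ?thesis by (simp add: exp_add distrib_left mult.assoc)
      qed
      from set_integral_vimage_zero[OF bdd[OF U Z] Xm this slice.hyps(3)]
      have "(LINT x:(X -` A \<inter> space M)|M. indicator U x *\<^sub>R \<phi> x * iexp (Z x)) = 0" .
      moreover have "(LINT x:(X -` A \<inter> space M)|M. indicator U x *\<^sub>R \<phi> x * iexp (Z x))
          = (\<integral>x. indicator (X -` A \<inter> U) x *\<^sub>R \<phi> x * iexp (Z x) \<partial>M)"
        unfolding set_lebesgue_integral_def
        by (intro Bochner_Integration.integral_cong) (auto simp: indicator_def)
      ultimately show "(\<integral>x. indicator (X -` A \<inter> U) x *\<^sub>R \<phi> x * iexp (Z x) \<partial>M) = 0" by simp
    qed
  qed
  have zero: "(\<lambda>_. 0) \<in> L" using lin by (simp add: linear_family_def)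
  let ?P = "cylinder_sets M L \<union> null_sets M"
  have "Int_stable ?P"
    using cylinder_sets_Int[OF _ _ L] cylinder_sets_measurable[OF _ L]
    by (intro Int_stableI) (elim UnE; simp add: null_set_Int1 null_set_Int2 null_setsD2)
  moreover have "?P \<subseteq> sets M" using cylinder_sets_measurable[OF _ L] by auto
  moreover have "(\<integral>x. \<phi> x \<partial>M) = 0" using fourier[OF zero] by simp
  moreover have "(LINT x:U|M. \<phi> x) = 0" if "U \<in> ?P" for U
  proof (cases "U \<in> null_sets M")
    case True
    then have "AE x in M. x \<notin> U" by (rule AE_not_in)
    then have "AE x in M. indicator U x *\<^sub>R \<phi> x = 0" by eventually_elim simp
    then show ?thesis unfolding set_lebesgue_integral_def by (rule integral_eq_zero_AE)
  next
    case False
    with that have "U \<in> cylinder_sets M L" by simp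
    from bspec[OF cyl[OF this] zero] show ?thesis by (simp add: set_lebesgue_integral_def)
  qed
  moreover have "A \<in> sigma_sets (space M) ?P"
  proof -
    have "{X -` A \<inter> space M | X A. X \<in> L \<and> A \<in> sets borel} \<subseteq> cylinder_sets M L"
      by (auto intro: cylinder_sets.intros)
    then have "sigma_sets (space M) ({X -` A \<inter> space M | X A. X \<in> L \<and> A \<in> sets borel} \<union> null_sets M)
        \<subseteq> sigma_sets (space M) ?P"
      by (intro sigma_sets_mono') auto
    moreover have "sets (sigma_of_process M (\<lambda>X. X) L)
        = sigma_sets (space M) ({X -` A \<inter> space M | X A. X \<in> L \<and> A \<in> sets borel} \<union> null_sets M)"
      by (rule sets_sigma_of_process)
    ultimately show ?thesis using A by (simp only: subset_eq)
  qed
  ultimately show ?thesis by (rule set_integral_zero_sigma_sets[OF int])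
qed

section \<open>Orthogonality and independence in Gaussian spaces\<close>

lemma (in prob_space) centered_gaussian_fourier:
  assumes X: "gaussian_var M X" and mean: "expectation X = 0"
  shows "integrable M (\<lambda>x. (X x)\<^sup>2)"
    and "(\<integral>x. iexp (X x) \<partial>M) = exp (- (expectation (\<lambda>x. (X x)\<^sup>2)) / 2)"
proof -
  have [measurable]: "X \<in> borel_measurable M" using X by (simp add: gaussian_var_def)
  consider \<mu> \<sigma> where "0 < \<sigma>" "distributed M lborel X (normal_density \<mu> \<sigma>)"
    | \<mu> where "AE x in M. X x = \<mu>"
    using X by (auto simp: gaussian_var_def)
  then have "integrable M (\<lambda>x. (X x)\<^sup>2) \<and>
     (\<integral>x. iexp (X x) \<partial>M) = exp (- (expectation (\<lambda>x. (X x)\<^sup>2)) / 2)"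
  proof cases
    case 1
    then have \<mu>: "\<mu> = 0" using normal_distributed_expectation mean by metis
    have D: "distributed M lborel X (normal_density 0 \<sigma>)" using 1 \<mu> by simp
    have "integrable lborel (\<lambda>x. normal_density 0 \<sigma> x * x ^ 2)"
      using integrable_normal_moment[OF 1(1), of 0 2] by simp
    then have i: "integrable M (\<lambda>x. (X x)\<^sup>2)"
      by (subst distributed_integrable[OF D, symmetric]) auto
    have v: "expectation (\<lambda>x. (X x)\<^sup>2) = \<sigma>\<^sup>2"
      using normal_distributed_variance[OF 1(1) D] mean by simp
    define Y where "Y = (\<lambda>x. X x / \<sigma>)"
    have Ym [measurable]: "Y \<in> borel_measurable M" unfolding Y_def by measurable
    have "distributed M lborel Y std_normal_density"
      using normal_standard_normal_convert[OF 1(1), of X 0] D by (simp add: Y_def)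
    then have "distr M lborel Y = std_normal_distribution"
      by (simp add: distributed_def)
    moreover have "distr M lborel Y = distr M borel Y" by (intro distr_cong) auto
    ultimately have "char (distr M borel Y) \<sigma> = exp (- \<sigma>\<^sup>2 / 2)"
      by (simp add: char_std_normal_distribution)
    moreover have "char (distr M borel Y) \<sigma> = (\<integral>x. iexp (\<sigma> * Y x) \<partial>M)"
      unfolding char_def by (subst integral_distr) auto
    moreover have "\<sigma> * Y x = X x" for x using 1 by (simp add: Y_def)
    ultimately show ?thesis using i v by simp
  next
    case 2
    have "expectation X = expectation (\<lambda>_. \<mu>)"
      using 2 by (intro integral_cong_AE) auto
    then have "\<mu> = 0" using mean by (simp add: prob_space)
    with 2 have ae: "AE x in M. X x = 0" by simp
    have "expectation (\<lambda>x. (X x)\<^sup>2) = expectation (\<lambda>_. 0)"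
      using ae by (intro integral_cong_AE) auto
    moreover have "(\<integral>x. iexp (X x) \<partial>M) = (\<integral>x. 1 \<partial>M)"
      using ae by (intro integral_cong_AE) auto
    moreover have "integrable M (\<lambda>x. (X x)\<^sup>2) \<longleftrightarrow> integrable M (\<lambda>_. 0::real)"
      using ae by (intro integrable_cong_AE) auto
    ultimately show ?thesis by (simp add: prob_space)
  qed
  then show "integrable M (\<lambda>x. (X x)\<^sup>2)"
    "(\<integral>x. iexp (X x) \<partial>M) = exp (- (expectation (\<lambda>x. (X x)\<^sup>2)) / 2)" by auto
qed

definition gaussian_space :: "'a measure \<Rightarrow> ('a \<Rightarrow> real) set \<Rightarrow> bool" where
  "gaussian_space M H \<longleftrightarrow> linear_family H \<and> (\<forall>X\<in>H. gaussian_var M X \<and> (\<integral>x. X x \<partial>M) = 0)"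

lemma (in prob_space) gaussian_space_integrable_mult:
  assumes H: "gaussian_space M H" and X: "X \<in> H" and Y: "Y \<in> H"
  shows "integrable M (\<lambda>x. X x * Y x)"
proof -
  have "(\<lambda>x. X x + 1 * Y x) \<in> H"
    using H X Y unfolding gaussian_space_def linear_family_def by blast
  then have "integrable M (\<lambda>x. (X x + Y x)\<^sup>2)" "integrable M (\<lambda>x. (X x)\<^sup>2)" "integrable M (\<lambda>x. (Y x)\<^sup>2)"
    using H X Y centered_gaussian_fourier(1) by (auto simp: gaussian_space_def)
  then have "integrable M (\<lambda>x. ((X x + Y x)\<^sup>2 - (X x)\<^sup>2 - (Y x)\<^sup>2) / 2)" by auto
  then show ?thesis by (simp add: power2_sum)
qed

text \<open>
  For \<open>X \<in> N\<close> and \<open>Y \<in> L\<close> the sum \<open>X + Y\<close> is Gaussian and its variance is the sum of the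
  variances, so the characteristic function factorises.  The exponentials are then replaced by
  indicators one side at a time: first \<open>iexp X\<close> by the indicator of \<open>U\<close>, using the density
  \<open>iexp Y - E (iexp Y)\<close>, then \<open>iexp Y\<close> by the indicator of \<open>V\<close>, using the density
  \<open>1\<^sub>U - P U\<close>.
\<close>

lemma (in prob_space) gaussian_orthogonal_indep:
  assumes H: "gaussian_space M H"
    and N: "N \<subseteq> H" "linear_family N" and L: "L \<subseteq> H" "linear_family L"
    and orth: "\<And>X Y. X \<in> N \<Longrightarrow> Y \<in> L \<Longrightarrow> expectation (\<lambda>x. X x * Y x) = 0"
    and U: "U \<in> sets (sigma_of_process M (\<lambda>X. X) N)"
    and V: "V \<in> sets (sigma_of_process M (\<lambda>X. X) L)"
  shows "prob (U \<inter> V) = prob U * prob V"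
proof -
  have meas: "Z \<in> borel_measurable M" if "Z \<in> H" for Z
    using H that by (auto simp: gaussian_space_def gaussian_var_def)
  have sub: "sets (sigma_of_process M (\<lambda>X. X) K) \<subseteq> sets M" if "K \<subseteq> H" for K
    using that meas by (subst sets_sigma_of_process) (auto intro!: sets.sigma_sets_subset)
  have UM [measurable]: "U \<in> sets M" and VM [measurable]: "V \<in> sets M"
    using U V sub N L by blast+
  have ie: "integrable M (\<lambda>x. iexp (Z x))" if "Z \<in> H" for Z
    using meas[OF that] by (intro integrable_iexp) auto
  have mult: "(\<integral>x. iexp (X x) * iexp (Y x) \<partial>M) = (\<integral>x. iexp (X x) \<partial>M) * (\<integral>x. iexp (Y x) \<partial>M)"
    if X: "X \<in> N" and Y: "Y \<in> L" for X Y
  proof -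
    have XH: "X \<in> H" and YH: "Y \<in> H" using X Y N L by auto
    have "(\<lambda>x. X x + 1 * Y x) \<in> H"
      using H XH YH unfolding gaussian_space_def linear_family_def by blast
    then have Z: "(\<lambda>x. X x + Y x) \<in> H" by simp
    have c: "integrable M (\<lambda>x. (Z x)\<^sup>2)"
        "(\<integral>x. iexp (Z x) \<partial>M) = exp (- (expectation (\<lambda>x. (Z x)\<^sup>2)) / 2)" if "Z \<in> H" for Z
      using H that centered_gaussian_fourier by (auto simp: gaussian_space_def)
    have "expectation (\<lambda>x. (X x + Y x)\<^sup>2) = expectation (\<lambda>x. (X x)\<^sup>2 + (Y x)\<^sup>2 + 2 * (X x * Y x))"
      by (simp add: power2_sum mult.assoc)
    also have "\<dots> = expectation (\<lambda>x. (X x)\<^sup>2) + expectation (\<lambda>x. (Y x)\<^sup>2)"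
      using c(1)[OF XH] c(1)[OF YH] gaussian_space_integrable_mult[OF H XH YH] orth[OF X Y] by simp
    finally have "(\<integral>x. iexp (X x + Y x) \<partial>M) = (\<integral>x. iexp (X x) \<partial>M) * (\<integral>x. iexp (Y x) \<partial>M)"
      unfolding c(2)[OF Z] c(2)[OF XH] c(2)[OF YH]
      by (simp add: exp_add[symmetric] of_real_mult[symmetric] add_divide_distrib del: of_real_mult)
    then show ?thesis by (simp add: distrib_left exp_add)
  qed
  have set_mult: "(LINT x:U|M. iexp (Y x)) = prob U * (\<integral>x. iexp (Y x) \<partial>M)" if Y: "Y \<in> L" for Y
  proof -
    define c where "c = (\<integral>x. iexp (Y x) \<partial>M)"
    have YH: "Y \<in> H" using Y L by auto
    have "(LINT x:U|M. iexp (Y x) - c) = 0"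
    proof (rule set_integral_zero_if_fourier_zero[OF _ N(2) _ _ U])
      show "integrable M (\<lambda>x. iexp (Y x) - c)" using ie[OF YH] by simp
      show "N \<subseteq> borel_measurable M" using N meas by auto
      fix X assume X: "X \<in> N"
      then have XH: "X \<in> H" using N by auto
      have "integrable M (\<lambda>x. iexp (X x) * iexp (Y x))"
        using ie[OF XH] meas[OF YH]
        by (rule_tac Bochner_Integration.integrable_bound[OF ie[OF XH]]) (auto simp: norm_mult)
      then have "(\<integral>x. iexp (X x) * iexp (Y x) - c * iexp (X x) \<partial>M) = 0"
        using ie[OF XH] mult[OF X Y] by (simp add: c_def)
      then show "(\<integral>x. (iexp (Y x) - c) * iexp (X x) \<partial>M) = 0"
        by (simp add: algebra_simps)
    qed
    moreover have "(LINT x:U|M. iexp (Y x) - c) = (LINT x:U|M. iexp (Y x)) - (LINT x:U|M. c)"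
      using ie[OF YH] UM
      by (intro set_integral_diff) (auto simp: set_integrable_def intro!: integrable_mult_indicator)
    moreover have "(LINT x:U|M. c) = prob U * c"
      using UM by (simp add: set_lebesgue_integral_def scaleR_conv_of_real)
    ultimately show ?thesis by (simp add: c_def)
  qed
  let ?\<psi> = "\<lambda>x. complex_of_real (indicator U x - prob U)"
  have "(LINT x:V|M. ?\<psi> x) = 0"
  proof (rule set_integral_zero_if_fourier_zero[OF _ L(2) _ _ V])
    show "integrable M ?\<psi>" using UM by (intro integrable_of_real Bochner_Integration.integrable_diff integrable_const integrable_real_indicator) (auto simp: less_top[symmetric])
    show "L \<subseteq> borel_measurable M" using L meas by auto
    fix Y assume Y: "Y \<in> L"
    then have YH: "Y \<in> H" using L by auto
    have "(\<integral>x. ?\<psi> x * iexp (Y x) \<partial>M) = (\<integral>x. indicator U x *\<^sub>R iexp (Y x) - prob U * iexp (Y x) \<partial>M)"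
      by (intro Bochner_Integration.integral_cong) (auto simp: algebra_simps scaleR_conv_of_real)
    also have "\<dots> = (LINT x:U|M. iexp (Y x)) - prob U * (\<integral>x. iexp (Y x) \<partial>M)"
      unfolding set_lebesgue_integral_def using ie[OF YH] UM
      by (subst Bochner_Integration.integral_diff) (auto intro!: integrable_mult_indicator)
    finally show "(\<integral>x. ?\<psi> x * iexp (Y x) \<partial>M) = 0" using set_mult[OF Y] by simp
  qed
  moreover have "(LINT x:V|M. ?\<psi> x) = (\<integral>x. complex_of_real (indicator (U \<inter> V) x - prob U * indicator V x) \<partial>M)"
    unfolding set_lebesgue_integral_def
    by (intro Bochner_Integration.integral_cong) (auto simp: indicator_def)
  moreover have "(\<integral>x. indicator (U \<inter> V) x - prob U * indicator V x \<partial>M) = prob (U \<inter> V) - prob U * prob V"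
    using UM VM by (subst Bochner_Integration.integral_diff) (auto intro!: integrable_real_indicator simp: less_top[symmetric])
  ultimately show ?thesis by (simp only: integral_complex_of_real of_real_eq_0_iff right_minus_eq)
qed

section \<open>Conditional expectations along decreasing families\<close>

lemma (in prob_space) finite_measure_subalgebra_of:
  "subalgebra M F \<Longrightarrow> finite_measure_subalgebra M F"
  by (simp add: finite_measure_subalgebra_def finite_measure_subalgebra_axioms_def finite_measure_axioms)

lemma (in prob_space) AE_cond_exp_abs_le_1:
  assumes F: "subalgebra M F" and f: "f \<in> borel_measurable M" "\<And>x. \<bar>f x\<bar> \<le> 1"
  shows "AE x in M. \<bar>real_cond_exp M F f x\<bar> \<le> 1"
proof -
  interpret finite_measure_subalgebra M F by (rule finite_measure_subalgebra_of[OF F])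
  have i: "integrable M f"
    using f by (intro integrable_const_bound[of _ 1]) auto
  have "AE x in M. real_cond_exp M F f x \<le> 1"
    using f(2) by (intro real_cond_exp_le_c[OF i]) (auto intro: AE_I2 simp: abs_le_iff)
  moreover have "AE x in M. real_cond_exp M F f x \<ge> -1"
    using f(2) by (intro real_cond_exp_ge_c[OF i]) (auto intro!: AE_I2 simp: abs_le_iff minus_le_iff)
  ultimately show ?thesis by eventually_elim auto
qed

text \<open>
  If \<open>N\<close> is independent of \<open>G\<close> and \<open>K \<subseteq> G\<close>, then for \<open>v \<in> G\<close> adjoining \<open>N\<close> to the
  conditioning \<open>\<sigma>\<close>-algebra \<open>K\<close> has no effect.  It suffices to test on \<open>u \<inter> k\<close> with \<open>u \<in> N\<close> and
  \<open>k \<in> K\<close>, and there the independent factor \<open>P u\<close> splits off.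
\<close>

lemma (in prob_space) cond_exp_drop_independent:
  assumes N: "subalgebra M N" and G: "subalgebra M G" and K: "subalgebra G K"
    and indep: "\<And>u v. u \<in> sets N \<Longrightarrow> v \<in> sets G \<Longrightarrow> prob (u \<inter> v) = prob u * prob v"
    and a: "a \<in> sigma_sets (space M) (sets N \<union> sets K)" and v: "v \<in> sets G"
  shows "(LINT x:a|M. indicator v x) = (LINT x:a|M. real_cond_exp M K (indicator v) x)"
proof -
  have KM: "subalgebra M K"
    using G K by (auto simp: subalgebra_def)
  interpret G: finite_measure_subalgebra M G by (rule finite_measure_subalgebra_of[OF G])
  interpret K: finite_measure_subalgebra M K by (rule finite_measure_subalgebra_of[OF KM])
  have NM: "sets N \<subseteq> sets M" and GM: "sets G \<subseteq> sets M" and KG: "sets K \<subseteq> sets G"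
    using N G K by (auto simp: subalgebra_def)
  have sp: "space N = space M" "space K = space M"
    using N KM by (auto simp: subalgebra_def)
  have vM [measurable]: "v \<in> sets M" using v GM by auto
  have indi: "integrable M (indicator w :: 'a \<Rightarrow> real)" if "w \<in> sets M" for w
    using that by (intro integrable_real_indicator) (auto simp: less_top[symmetric])
  \<comment> \<open>The integrals of \<open>\<phi>\<close> over sets of \<open>K\<close> vanish by definition; the claim is that they vanish
    over sets of the \<open>\<sigma>\<close>-algebra generated by \<open>N\<close> and \<open>K\<close>.\<close>
  define \<phi> where "\<phi> = (\<lambda>x. indicator v x - real_cond_exp M K (indicator v) x)"
  have ci: "integrable M (real_cond_exp M K (indicator v))"
    by (intro K.real_cond_exp_int indi vM)
  have int: "integrable M \<phi>"
    unfolding \<phi>_def using ci indi[OF vM] by (rule Bochner_Integration.integrable_diff[rotated])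
  have phiG: "\<phi> \<in> borel_measurable G"
    unfolding \<phi>_def
    by (intro borel_measurable_diff borel_measurable_indicator v measurable_from_subalg[OF K]
      borel_measurable_cond_exp)
  have diff: "(LINT x:w|M. \<phi> x) = (LINT x:w|M. indicator v x) - (LINT x:w|M. real_cond_exp M K (indicator v) x)"
    if "w \<in> sets M" for w
    unfolding \<phi>_def using that ci indi[OF vM]
    by (intro set_integral_diff; unfold set_integrable_def; intro integrable_mult_indicator; simp)
  have kzero: "(LINT x:k|M. \<phi> x) = 0" if "k \<in> sets K" for k
    using K.real_cond_exp_intA[OF indi[OF vM] that] diff[of k] that KG GM by auto
  let ?P = "{u \<inter> k | u k. u \<in> sets N \<and> k \<in> sets K}"
  have basic: "(LINT x:(u \<inter> k)|M. \<phi> x) = 0" if u: "u \<in> sets N" and k: "k \<in> sets K" for u k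
  proof -
    have uM [measurable]: "u \<in> sets M" and kM [measurable]: "k \<in> sets M" and kG: "k \<in> sets G"
      using u k NM KG GM by auto
    have E: "AE x in M. real_cond_exp M G (indicator u) x = prob u"
    proof (rule G.real_cond_exp_charact)
      fix w assume w: "w \<in> sets G"
      then have [measurable]: "w \<in> sets M" using GM by auto
      have "(LINT x:w|M. indicator u x) = (\<integral>x. indicator (u \<inter> w) x \<partial>M)"
        unfolding set_lebesgue_integral_def
        by (intro Bochner_Integration.integral_cong) (auto simp: indicator_def)
      also have "\<dots> = prob u * prob w" using indep[OF u w] by simp
      finally show "(LINT x:w|M. indicator u x) = (LINT x:w|M. prob u)"
        by (simp add: set_lebesgue_integral_def)
    qed (auto intro: indi)
    have kphi: "integrable M (\<lambda>x. indicator k x * \<phi> x)"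
      using integrable_mult_indicator[OF kM int] by simp
    have "(LINT x:(u \<inter> k)|M. \<phi> x) = (\<integral>x. (indicator k x * \<phi> x) * indicator u x \<partial>M)"
      unfolding set_lebesgue_integral_def
      by (intro Bochner_Integration.integral_cong) (auto simp: indicator_def)
    also have "\<dots> = (\<integral>x. (indicator k x * \<phi> x) * real_cond_exp M G (indicator u) x \<partial>M)"
    proof (rule G.real_cond_exp_intg(2)[symmetric])
      show "integrable M (\<lambda>x. indicator k x * \<phi> x * indicator u x)"
        using integrable_mult_indicator[OF uM kphi] by (simp add: mult.commute)
      show "(\<lambda>x. indicator k x * \<phi> x) \<in> borel_measurable G"
        using kG phiG by (intro borel_measurable_times borel_measurable_indicator)
    qed measurable
    also have "\<dots> = (\<integral>x. (indicator k x * \<phi> x) * prob u \<partial>M)"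
      using E kphi measurable_from_subalg[OF G borel_measurable_cond_exp]
      by (intro integral_cong_AE) auto
    also have "\<dots> = 0" using kzero[OF k] by (simp add: set_lebesgue_integral_def)
    finally show ?thesis .
  qed
  have "Int_stable ?P"
  proof (rule Int_stableI)
    fix x y assume "x \<in> ?P" "y \<in> ?P"
    then obtain u k u' k' where *: "x = u \<inter> k" "y = u' \<inter> k'" "u \<in> sets N" "u' \<in> sets N" "k \<in> sets K" "k' \<in> sets K"
      by blast
    have "x \<inter> y = (u \<inter> u') \<inter> (k \<inter> k')" using * by blast
    moreover have "u \<inter> u' \<in> sets N" "k \<inter> k' \<in> sets K" using * by auto
    ultimately show "x \<inter> y \<in> ?P" by blast
  qed
  moreover have "?P \<subseteq> sets M" using NM KG GM by blast
  moreover have "(\<integral>x. \<phi> x \<partial>M) = 0"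
  proof -
    have "(LINT x:space M|M. \<phi> x) = (\<integral>x. \<phi> x \<partial>M)"
      unfolding set_lebesgue_integral_def by (intro Bochner_Integration.integral_cong) auto
    then show ?thesis using kzero[OF sets.top] sp by simp
  qed
  moreover have "(LINT x:w|M. \<phi> x) = 0" if "w \<in> ?P" for w using that basic by blast
  moreover have aP: "a \<in> sigma_sets (space M) ?P"
  proof -
    have "sets N \<union> sets K \<subseteq> ?P"
    proof
      fix w assume "w \<in> sets N \<union> sets K"
      then show "w \<in> ?P"
      proof
        assume w: "w \<in> sets N"
        then have "w = w \<inter> space K" using sets.sets_into_space[OF w] sp by auto
        with w show ?thesis by blast
      next
        assume w: "w \<in> sets K"
        then have "w = space N \<inter> w" using sets.sets_into_space[OF w] sp by auto
        with w show ?thesis by blast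
      qed
    qed
    then show ?thesis using a sigma_sets_mono'[of "sets N \<union> sets K" ?P "space M"] by (simp only: subset_eq)
  qed
  ultimately have "(LINT x:a|M. \<phi> x) = 0" by (rule set_integral_zero_sigma_sets[OF int])
  moreover have "a \<in> sets M"
    using aP sets.sigma_sets_subset[OF \<open>?P \<subseteq> sets M\<close>] by (simp only: subset_eq)
  ultimately show ?thesis using diff by simp
qed

text \<open>
  A form of Levy's downward theorem that is sufficient here.  With \<open>h n = E (f | G n)\<close>, the
  square norms \<open>q n\<close> decrease and \<open>\<parallel>h n - h m\<parallel>\<^sup>2 = q n - q m\<close> for \<open>n \<le> m\<close>, so \<open>h\<close> is Cauchy in
  \<open>L\<^sup>2\<close>.  A subsequence with geometrically small increments converges almost everywhere; its limit
  is measurable with respect to every \<open>G n\<close>, hence with respect to their intersection.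
\<close>

lemma (in prob_space) cond_exp_decreasing_subseq:
  fixes f :: "'a \<Rightarrow> real" and G :: "nat \<Rightarrow> 'a measure"
  assumes G: "\<And>n. subalgebra M (G n)" and dec: "\<And>n m. n \<le> m \<Longrightarrow> sets (G m) \<subseteq> sets (G n)"
    and H: "subalgebra M H" "sets H = (\<Inter>n. sets (G n))"
    and f [measurable]: "f \<in> borel_measurable M" and bd: "\<And>x. \<bar>f x\<bar> \<le> 1"
  shows "\<exists>r. strict_mono r \<and>
    (AE x in M. (\<lambda>k. real_cond_exp M (G (r k)) f x) \<longlonglongrightarrow> real_cond_exp M H f x)"
proof -
  interpret H: finite_measure_subalgebra M H by (rule finite_measure_subalgebra_of[OF H(1)])
  define h where "h = (\<lambda>n. real_cond_exp M (G n) f)"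
  have hG: "h n \<in> borel_measurable (G n)" for n unfolding h_def by (rule borel_measurable_cond_exp)
  have hM [measurable]: "h n \<in> borel_measurable M" for n
    by (rule measurable_from_subalg[OF G hG])
  have GG: "subalgebra (G n) (G m)" if "n \<le> m" for n m
    using G dec[OF that] by (auto simp: subalgebra_def)
  have hbd: "AE x in M. \<bar>h n x\<bar> \<le> 1" for n
    unfolding h_def by (rule AE_cond_exp_abs_le_1[OF G f bd])
  have fi: "integrable M f" using bd by (intro integrable_const_bound[of _ 1]) auto
  have hi: "integrable M (h n)" for n using hbd by (intro integrable_const_bound[of _ 1]) auto
  have hhi: "integrable M (\<lambda>x. h n x * h m x)" for n m
  proof (rule integrable_const_bound[of _ 1])
    show "AE x in M. norm (h n x * h m x) \<le> 1"
      using hbd[of n] hbd[of m] by eventually_elim (auto simp: abs_mult intro!: mult_le_one)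
  qed measurable
  have hfi: "integrable M (\<lambda>x. h n x * f x)" for n
  proof (rule integrable_const_bound[of _ 1])
    show "AE x in M. norm (h n x * f x) \<le> 1"
      using hbd[of n] by eventually_elim (simp add: abs_mult bd mult_le_one)
  qed measurable
  define q where "q = (\<lambda>n. \<integral>x. h n x * h n x \<partial>M)"
  have cross: "(\<integral>x. h m x * h n x \<partial>M) = (\<integral>x. h m x * f x \<partial>M)" if "n \<le> m" for n m
  proof -
    interpret finite_measure_subalgebra M "G n" by (rule finite_measure_subalgebra_of[OF G])
    show ?thesis
      unfolding h_def
      by (rule real_cond_exp_intg(2)) (use hfi[of m] in \<open>auto simp: h_def intro!: measurable_from_subalg[OF GG[OF that]]\<close>)
  qed
  have sq: "(\<integral>x. (h n x - h m x)\<^sup>2 \<partial>M) = q n - q m" if "n \<le> m" for n m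
  proof -
    have "(\<integral>x. (h n x - h m x)\<^sup>2 \<partial>M) = (\<integral>x. h n x * h n x - 2 * (h m x * h n x) + h m x * h m x \<partial>M)"
      by (intro Bochner_Integration.integral_cong) (auto simp: power2_eq_square algebra_simps)
    also have "\<dots> = q n - 2 * (\<integral>x. h m x * h n x \<partial>M) + q m"
      unfolding q_def using hhi by simp
    finally show ?thesis using cross[OF that] cross[of m m] by (simp add: q_def)
  qed
  have "decseq q"
  proof (rule decseq_SucI)
    fix n
    have "0 \<le> (\<integral>x. (h n x - h (Suc n) x)\<^sup>2 \<partial>M)" by simp
    then show "q (Suc n) \<le> q n" using sq[of n "Suc n"] by simp
  qed
  moreover have "0 \<le> q n" for n unfolding q_def by simp
  ultimately obtain L where L: "q \<longlonglongrightarrow> L" "\<And>n. L \<le> q n"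
    using decseq_convergent[of q 0] by auto
  have ex: "\<exists>N. \<forall>n\<ge>N. q n - L < (1/4) ^ k" for k :: nat
    using order_tendstoD(2)[OF L(1), of "L + (1/4) ^ k"]
    by (auto simp: eventually_sequentially algebra_simps)
  have "\<exists>r. \<forall>k. q (r k) - L < (1/4) ^ k \<and> r k < r (Suc k)"
  proof (rule dependent_nat_choice)
    show "\<exists>n. q n - L < (1/4) ^ 0" using ex[of 0] by auto
    fix n k
    obtain N where "\<forall>n\<ge>N. q n - L < (1/4) ^ Suc k" using ex by blast
    then show "\<exists>m. q m - L < (1/4) ^ Suc k \<and> n < m"
      by (intro exI[of _ "max N (Suc n)"]) auto
  qed
  then obtain r where r: "\<And>k. q (r k) - L < (1/4) ^ k" "strict_mono r"
    by (auto simp: strict_mono_Suc_iff)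
  define d where "d = (\<lambda>k x. h (r (Suc k)) x - h (r k) x)"
  have [measurable]: "d k \<in> borel_measurable M" for k unfolding d_def by measurable
  have d2i: "integrable M (\<lambda>x. (d k x)\<^sup>2)" for k
  proof -
    have "integrable M (\<lambda>x. h (r (Suc k)) x * h (r (Suc k)) x - 2 * (h (r (Suc k)) x * h (r k) x) + h (r k) x * h (r k) x)"
      using hhi by auto
    then show ?thesis by (simp add: d_def power2_eq_square algebra_simps)
  qed
  have di: "integrable M (d k)" for k unfolding d_def using hi by auto
  have d1: "(\<integral>x. \<bar>d k x\<bar> \<partial>M) \<le> (1/2) ^ k" for k
  proof -
    have "(\<integral>x. (d k x)\<^sup>2 \<partial>M) = q (r k) - q (r (Suc k))"
      using sq[of "r k" "r (Suc k)"] r(2)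
      by (simp add: d_def power2_commute strict_mono_less_eq)
    also have "\<dots> \<le> (1/4) ^ k" using r(1)[of k] L(2)[of "r (Suc k)"] by simp
    finally have le: "(\<integral>x. (d k x)\<^sup>2 \<partial>M) \<le> (1/4) ^ k" .
    \<comment> \<open>The inequality of arithmetic and geometric means with weight \<open>2 ^ k\<close>: it turns an \<open>L\<^sup>2\<close>
      bound \<open>(1/4) ^ k\<close> into an \<open>L\<^sup>1\<close> bound \<open>(1/2) ^ k\<close>.\<close>
    have am: "\<bar>y\<bar> \<le> ((1/2) ^ k + 2 ^ k * y\<^sup>2) / 2" for y :: real
    proof -
      have "0 \<le> ((2 ^ k * \<bar>y\<bar> - 1)\<^sup>2) * (1/2) ^ k" by simp
      also have "\<dots> = (2 ^ k * (1/2) ^ k) * (2 ^ k * y\<^sup>2) - 2 * (2 ^ k * (1/2) ^ k) * \<bar>y\<bar> + (1/2) ^ k"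
        by (simp add: power2_eq_square algebra_simps)
      also have "(2::real) ^ k * (1/2) ^ k = 1" by (simp add: power_one_over)
      finally show ?thesis by simp
    qed
    have "(\<integral>x. \<bar>d k x\<bar> \<partial>M) \<le> (\<integral>x. ((1/2) ^ k + 2 ^ k * (d k x)\<^sup>2) / 2 \<partial>M)"
      using d2i di am by (intro integral_mono) auto
    also have "\<dots> = ((1/2) ^ k + 2 ^ k * (\<integral>x. (d k x)\<^sup>2 \<partial>M)) / 2"
      using d2i by (simp add: prob_space)
    also have "\<dots> \<le> ((1/2) ^ k + 2 ^ k * (1/4) ^ k) / 2"
      using le by simp
    also have "(2::real) ^ k * (1/4) ^ k = (1/2) ^ k"
      by (simp add: power_mult_distrib[symmetric])
    finally show ?thesis by simp
  qed
  have "(\<integral>\<^sup>+x. (\<Sum>k. ennreal \<bar>d k x\<bar>) \<partial>M) = (\<Sum>k. ennreal (\<integral>x. \<bar>d k x\<bar> \<partial>M))"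
    using di by (subst nn_integral_suminf) (auto simp: nn_integral_eq_integral)
  also have "\<dots> \<le> (\<Sum>k. ennreal ((1/2) ^ k))"
    using d1 by (intro suminf_le) (auto intro: ennreal_leI)
  also have "\<dots> < \<infinity>"
    by (subst suminf_ennreal2) (auto intro: summable_geometric)
  finally have "(\<integral>\<^sup>+x. (\<Sum>k. ennreal \<bar>d k x\<bar>) \<partial>M) \<noteq> \<infinity>" by simp
  then have "AE x in M. (\<Sum>k. ennreal \<bar>d k x\<bar>) \<noteq> \<infinity>"
    by (intro nn_integral_noteq_infinite) auto
  then have conv: "AE x in M. convergent (\<lambda>k. h (r k) x)"
  proof eventually_elim
    case (elim x)
    then have "summable (\<lambda>k. \<bar>d k x\<bar>)" by (intro summable_suminf_not_top) auto
    then have "summable (\<lambda>k. d k x)" by (rule summable_rabs_cancel)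
    then have "(\<lambda>n. \<Sum>k<n. d k x) \<longlonglongrightarrow> (\<Sum>k. d k x)" by (rule summable_LIMSEQ)
    then have "(\<lambda>n. (h (r n) x - h (r 0) x) + h (r 0) x) \<longlonglongrightarrow> (\<Sum>k. d k x) + h (r 0) x"
      unfolding d_def by (intro tendsto_add) (auto simp: sum_lessThan_telescope[of "\<lambda>k. h (r k) x"])
    then show ?case by (auto simp: convergent_def)
  qed
  define g where "g = (\<lambda>x. lim (\<lambda>k. h (r k) x))"
  have gl: "AE x in M. (\<lambda>k. h (r k) x) \<longlonglongrightarrow> g x"
    using conv by eventually_elim (simp add: g_def convergent_LIMSEQ_iff)
  \<comment> \<open>Dropping the first \<open>n\<close> terms leaves the limit unchanged, and \<open>r (k + n) \<ge> n\<close>.\<close>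
  have "g \<in> borel_measurable (G n)" for n
  proof -
    have shift: "(\<lambda>k. u (k + n)) \<longlonglongrightarrow> l \<longleftrightarrow> u \<longlonglongrightarrow> l" for u :: "nat \<Rightarrow> real" and l
      by (rule iffI) (erule LIMSEQ_offset, erule LIMSEQ_ignore_initial_segment)
    have "g = (\<lambda>x. lim (\<lambda>k. h (r (k + n)) x))"
      unfolding g_def lim_def
      by (simp only: shift[of "\<lambda>k. h (r k) _"])
    moreover have "h (r (k + n)) \<in> borel_measurable (G n)" for k
      using seq_suble[OF r(2), of "k + n"]
      by (intro measurable_from_subalg[OF GG hG]) auto
    ultimately show ?thesis by (simp add: borel_measurable_lim_metric)
  qed
  then have gH: "g \<in> borel_measurable H"
    using H G unfolding subalgebra_def by (intro measurableI) (auto intro: measurable_sets simp: measurable_def)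
  have gM [measurable]: "g \<in> borel_measurable M" by (rule measurable_from_subalg[OF H(1) gH])
  have allbd: "AE x in M. \<forall>n. \<bar>h n x\<bar> \<le> 1" using hbd by (simp add: AE_all_countable)
  have "AE x in M. \<bar>g x\<bar> \<le> 1"
    using gl allbd
  proof eventually_elim
    case (elim x)
    show ?case
      by (rule LIMSEQ_le_const2[OF tendsto_rabs[OF elim(1)]]) (use elim in auto)
  qed
  then have gi: "integrable M g" by (intro integrable_const_bound[of _ 1]) auto
  have "AE x in M. real_cond_exp M H f x = g x"
  proof (rule H.real_cond_exp_charact[OF _ fi gi gH])
    fix A assume A: "A \<in> sets H"
    then have AG: "A \<in> sets (G n)" for n using H by auto
    have [measurable]: "A \<in> sets M" using A H(1) by (auto simp: subalgebra_def)
    have "(\<lambda>k. LINT x:A|M. h (r k) x) \<longlonglongrightarrow> (LINT x:A|M. g x)"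
      unfolding set_lebesgue_integral_def
    proof (rule integral_dominated_convergence[where w = "\<lambda>_. 1"])
      show "AE x in M. (\<lambda>k. indicator A x *\<^sub>R h (r k) x) \<longlonglongrightarrow> indicator A x *\<^sub>R g x"
        using gl by eventually_elim (intro tendsto_intros)
      show "AE x in M. norm (indicator A x *\<^sub>R h (r k) x) \<le> 1" for k
        using hbd[of "r k"] by eventually_elim (auto split: split_indicator)
    qed auto
    moreover have "(LINT x:A|M. h n x) = (LINT x:A|M. f x)" for n
    proof -
      interpret finite_measure_subalgebra M "G n" by (rule finite_measure_subalgebra_of[OF G])
      show ?thesis unfolding h_def using real_cond_exp_intA[OF fi AG[of n]] by simp
    qed
    ultimately show "(LINT x:A|M. f x) = (LINT x:A|M. g x)"
      by (simp add: LIMSEQ_const_iff)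
  qed
  with gl have "AE x in M. (\<lambda>k. h (r k) x) \<longlonglongrightarrow> real_cond_exp M H f x"
    by eventually_elim simp
  with r(2) show ?thesis unfolding h_def by blast
qed

text \<open>
  Conditional independence passes to decreasing intersections of the conditioning
  \<open>\<sigma>\<close>-algebras.  The hypothesis is the identity
  \<open>E (1\<^sub>b | A \<or> G n) = E (1\<^sub>b | G n)\<close>, tested only on intersections of sets of \<open>A\<close> and
  \<open>H\<close>.  In it only one factor depends on \<open>n\<close>, so that almost sure convergence of this factor
  along a subsequence is enough.
\<close>

lemma (in prob_space) cond_indep_decreasing:
  fixes G :: "nat \<Rightarrow> 'a measure"
  assumes A: "subalgebra M A" and B: "subalgebra M B"
    and G: "\<And>n. subalgebra M (G n)" and dec: "\<And>n m. n \<le> m \<Longrightarrow> sets (G m) \<subseteq> sets (G n)"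
    and H: "subalgebra M H" "sets H = (\<Inter>n. sets (G n))"
    and ci: "\<And>n a b k. a \<in> sets A \<Longrightarrow> b \<in> sets B \<Longrightarrow> k \<in> sets H \<Longrightarrow>
      (LINT x:(a \<inter> k)|M. indicator b x) = (LINT x:(a \<inter> k)|M. real_cond_exp M (G n) (indicator b) x)"
  shows "cond_indep M A B H"
  unfolding cond_indep_def
proof (intro conjI ballI A B H)
  fix a b assume a: "a \<in> sets A" and b: "b \<in> sets B"
  interpret H: finite_measure_subalgebra M H by (rule finite_measure_subalgebra_of[OF H(1)])
  have aM [measurable]: "a \<in> sets M" and bM [measurable]: "b \<in> sets M"
    using a b A B by (auto simp: subalgebra_def)
  have indi: "integrable M (indicator w :: 'a \<Rightarrow> real)" if "w \<in> sets M" for w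
    using that by (intro integrable_real_indicator) (auto simp: less_top[symmetric])
  let ?Ea = "real_cond_exp M H (indicator a)" and ?Eb = "real_cond_exp M H (indicator b)"
  have EH: "?Ea \<in> borel_measurable H" "?Eb \<in> borel_measurable H"
    by (rule borel_measurable_cond_exp)+
  note [measurable] = EH[THEN measurable_from_subalg[OF H(1)]]
  have bdi: "\<bar>indicator w x :: real\<bar> \<le> 1" for w and x :: 'a by (simp split: split_indicator)
  have Ebd: "AE x in M. \<bar>?Ea x\<bar> \<le> 1" "AE x in M. \<bar>?Eb x\<bar> \<le> 1"
    by (intro AE_cond_exp_abs_le_1[OF H(1)] bdi; simp)+
  obtain r where r: "AE x in M. (\<lambda>k. real_cond_exp M (G (r k)) (indicator b) x) \<longlonglongrightarrow> ?Eb x"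
    using cond_exp_decreasing_subseq[OF G dec H, of "indicator b"] bdi by auto
  show "AE x in M. real_cond_exp M H (indicator (a \<inter> b)) x = ?Ea x * ?Eb x"
  proof (rule H.real_cond_exp_charact)
    show "integrable M (indicator (a \<inter> b) :: 'a \<Rightarrow> real)" by (intro indi) auto
    show "integrable M (\<lambda>x. ?Ea x * ?Eb x)"
    proof (rule integrable_const_bound[of _ 1])
      show "AE x in M. norm (?Ea x * ?Eb x) \<le> 1"
        using Ebd by eventually_elim (auto simp: abs_mult intro!: mult_le_one)
    qed measurable
    show "(\<lambda>x. ?Ea x * ?Eb x) \<in> borel_measurable H" using EH by (rule borel_measurable_times)
    fix k assume k: "k \<in> sets H"
    then have kM [measurable]: "k \<in> sets M" using H(1) by (auto simp: subalgebra_def)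
    have "(\<lambda>n. LINT x:(a \<inter> k)|M. real_cond_exp M (G (r n)) (indicator b) x) \<longlonglongrightarrow> (LINT x:(a \<inter> k)|M. ?Eb x)"
      unfolding set_lebesgue_integral_def
    proof (rule integral_dominated_convergence[where w = "\<lambda>_. 1"])
      show "AE x in M. (\<lambda>n. indicator (a \<inter> k) x *\<^sub>R real_cond_exp M (G (r n)) (indicator b) x)
          \<longlonglongrightarrow> indicator (a \<inter> k) x *\<^sub>R ?Eb x"
        using r by eventually_elim (intro tendsto_intros)
      have "AE x in M. \<bar>real_cond_exp M (G (r n)) (indicator b) x\<bar> \<le> 1" for n
        by (intro AE_cond_exp_abs_le_1[OF G] bdi) simp
      then show "AE x in M. norm (indicator (a \<inter> k) x *\<^sub>R real_cond_exp M (G (r n)) (indicator b) x) \<le> 1" for n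
        by (rule eventually_mono) (auto split: split_indicator)
      show "(\<lambda>x. indicator (a \<inter> k) x *\<^sub>R real_cond_exp M (G (r n)) (indicator b) x) \<in> borel_measurable M" for n
        using measurable_from_subalg[OF G borel_measurable_cond_exp] by measurable
    qed auto
    then have lim: "(LINT x:(a \<inter> k)|M. indicator b x) = (LINT x:(a \<inter> k)|M. ?Eb x)"
      using ci[OF a b k] by (simp add: LIMSEQ_const_iff)
    have "(LINT x:k|M. indicator (a \<inter> b) x) = (LINT x:(a \<inter> k)|M. indicator b x :: real)"
      unfolding set_lebesgue_integral_def
      by (intro Bochner_Integration.integral_cong) (auto simp: indicator_def)
    also have "\<dots> = (\<integral>x. (indicator k x * ?Eb x) * indicator a x \<partial>M)"
      unfolding lim unfolding set_lebesgue_integral_def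
      by (intro Bochner_Integration.integral_cong) (auto simp: indicator_def)
    also have "\<dots> = (\<integral>x. (indicator k x * ?Eb x) * ?Ea x \<partial>M)"
    proof (rule H.real_cond_exp_intg(2)[symmetric])
      show "integrable M (\<lambda>x. indicator k x * ?Eb x * indicator a x)"
      proof (rule integrable_const_bound[of _ 1])
        show "AE x in M. norm (indicator k x * ?Eb x * indicator a x) \<le> 1"
          using Ebd(2) by eventually_elim (auto split: split_indicator)
      qed measurable
      show "(\<lambda>x. indicator k x * ?Eb x) \<in> borel_measurable H"
        using k EH by (intro borel_measurable_times borel_measurable_indicator)
    qed measurable
    also have "\<dots> = (LINT x:k|M. ?Ea x * ?Eb x)"
      unfolding set_lebesgue_integral_def
      by (intro Bochner_Integration.integral_cong) auto
    finally show "(LINT x:k|M. indicator (a \<inter> b) x) = (LINT x:k|M. ?Ea x * ?Eb x)" .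
  qed
qed

section \<open>Linear combinations and germ fields of a process\<close>

definition linear_combinations :: "('t \<Rightarrow> 'a \<Rightarrow> real) \<Rightarrow> 't set \<Rightarrow> ('a \<Rightarrow> real) set" where
  "linear_combinations X S = {\<lambda>\<omega>. \<Sum>t\<in>I. c t * X t \<omega> | I c. finite I \<and> I \<subseteq> S}"

lemma linear_combinations_mono: "S \<subseteq> S' \<Longrightarrow> linear_combinations X S \<subseteq> linear_combinations X S'"
  unfolding linear_combinations_def by blast

lemma linear_combinations_base: "s \<in> S \<Longrightarrow> X s \<in> linear_combinations X S"
  unfolding linear_combinations_def
  by (rule CollectI, rule exI[of _ "{s}"], rule exI[of _ "\<lambda>_. 1"]) auto

lemma linear_family_linear_combinations: "linear_family (linear_combinations X S)"
  unfolding linear_family_def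
proof (intro conjI ballI allI)
  show "(\<lambda>_. 0) \<in> linear_combinations X S"
    unfolding linear_combinations_def by (rule CollectI, rule exI[of _ "{}"]) auto
  fix Y Z and t :: real
  assume "Y \<in> linear_combinations X S" "Z \<in> linear_combinations X S"
  then obtain I c J d where I: "finite I" "I \<subseteq> S" "Y = (\<lambda>\<omega>. \<Sum>t\<in>I. c t * X t \<omega>)"
    and J: "finite J" "J \<subseteq> S" "Z = (\<lambda>\<omega>. \<Sum>t\<in>J. d t * X t \<omega>)"
    unfolding linear_combinations_def by blast
  define e where "e = (\<lambda>s. (if s \<in> I then c s else 0) + t * (if s \<in> J then d s else 0))"
  have "Y \<omega> + t * Z \<omega> = (\<Sum>s\<in>I \<union> J. e s * X s \<omega>)" for \<omega>
  proof -
    have "(\<Sum>s\<in>I \<union> J. e s * X s \<omega>)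
        = (\<Sum>s\<in>I \<union> J. if s \<in> I then c s * X s \<omega> else 0) + t * (\<Sum>s\<in>I \<union> J. if s \<in> J then d s * X s \<omega> else 0)"
      by (simp add: e_def sum_distrib_left sum.distrib[symmetric] distrib_right mult.assoc if_distrib[of "\<lambda>x. x * _"] if_distrib[of "\<lambda>x. _ * x"] cong: if_cong)
    also have "(\<Sum>s\<in>I \<union> J. if s \<in> I then c s * X s \<omega> else 0) = (\<Sum>s\<in>I. c s * X s \<omega>)"
      using I(1) J(1) by (subst sum.inter_restrict[symmetric]) (auto intro: sum.cong)
    also have "(\<Sum>s\<in>I \<union> J. if s \<in> J then d s * X s \<omega> else 0) = (\<Sum>s\<in>J. d s * X s \<omega>)"
      using I(1) J(1) by (subst sum.inter_restrict[symmetric]) (auto intro: sum.cong)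
    finally show ?thesis by (simp add: I(3) J(3))
  qed
  then have "(\<lambda>\<omega>. Y \<omega> + t * Z \<omega>) = (\<lambda>\<omega>. \<Sum>s\<in>I \<union> J. e s * X s \<omega>)" by simp
  moreover have "finite (I \<union> J)" "I \<union> J \<subseteq> S" using I J by auto
  ultimately show "(\<lambda>\<omega>. Y \<omega> + t * Z \<omega>) \<in> linear_combinations X S"
    unfolding linear_combinations_def by blast
qed

lemma null_sets_subset_sigma_of_process:
  "null_sets M \<subseteq> sets (sigma_of_process M X S)"
  unfolding sets_sigma_of_process by auto

lemma measurable_sigma_of_process:
  assumes "s \<in> S"
  shows "X s \<in> borel_measurable (sigma_of_process M X S)"
  using assms by (intro measurableI) (auto simp: sets_sigma_of_process intro!: sigma_sets.Basic)

lemma sets_sigma_of_process_subset: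
  assumes "space F = space M" "null_sets M \<subseteq> sets F"
    and "\<And>s. s \<in> S \<Longrightarrow> X s \<in> borel_measurable F"
  shows "sets (sigma_of_process M X S) \<subseteq> sets F"
proof -
  let ?g = "{X s -` A \<inter> space M | s A. s \<in> S \<and> A \<in> sets borel} \<union> null_sets M"
  have "?g \<subseteq> sets F"
    using assms(2) measurable_sets[OF assms(3)] unfolding assms(1) by blast
  then have "sigma_sets (space F) ?g \<subseteq> sets F" by (rule sets.sigma_sets_subset)
  then show ?thesis unfolding sets_sigma_of_process assms(1) .
qed

lemma sigma_of_process_mono:
  "S \<subseteq> S' \<Longrightarrow> sets (sigma_of_process M X S) \<subseteq> sets (sigma_of_process M X S')"
  by (rule sets_sigma_of_process_subset)
    (auto intro!: null_sets_subset_sigma_of_process measurable_sigma_of_process)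

lemma subalgebra_sigma_of_process:
  "(\<And>s. s \<in> S \<Longrightarrow> X s \<in> borel_measurable M) \<Longrightarrow> subalgebra M (sigma_of_process M X S)"
  using sets_sigma_of_process_subset[of M M S X] by (auto simp: subalgebra_def)

text \<open>
  Conditional independence for Gaussian families.  The regression hypothesis splits each
  \<open>X s\<close> into a part in the span of \<open>K\<close> and a residual orthogonal to everything indexed by
  \<open>C \<union> K\<close>.  All such residuals lie in the orthogonal complement \<open>N\<close> of the span \<open>L\<close> of
  \<open>C \<union> K\<close>, so together they are independent of \<open>L\<close>.
\<close>

lemma (in prob_space) gaussian_separation:
  assumes H: "gaussian_space M (linear_combinations X T)"
    and sub: "A \<subseteq> T" "C \<subseteq> T" "K \<subseteq> T"
    and regression: "\<And>s. s \<in> A \<Longrightarrow>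
      \<exists>Z\<in>linear_combinations X K. \<forall>u\<in>C \<union> K. expectation (\<lambda>x. (X s x - Z x) * X u x) = 0"
    and a: "a \<in> sets (sigma_of_process M X A)" and k: "k \<in> sets (sigma_of_process M X K)"
    and b: "b \<in> sets (sigma_of_process M X C)"
  shows "(LINT x:(a \<inter> k)|M. indicator b x) =
    (LINT x:(a \<inter> k)|M. real_cond_exp M (sigma_of_process M X K) (indicator b) x)"
proof -
  define L where "L = linear_combinations X (C \<union> K)"
  define N where "N = {Y \<in> linear_combinations X T. \<forall>Z\<in>L. expectation (\<lambda>x. Y x * Z x) = 0}"
  let ?N = "sigma_of_process M (\<lambda>Y. Y) N" and ?G = "sigma_of_process M (\<lambda>Y. Y) L"
  let ?K = "sigma_of_process M X K"
  have LT: "L \<subseteq> linear_combinations X T"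
    unfolding L_def using sub by (intro linear_combinations_mono) auto
  have NT: "N \<subseteq> linear_combinations X T" unfolding N_def by auto
  have meas: "Y \<in> borel_measurable M" if "Y \<in> linear_combinations X T" for Y
    using H that by (auto simp: gaussian_space_def gaussian_var_def)
  have Xm: "X s \<in> borel_measurable M" if "s \<in> T" for s
    by (intro meas linear_combinations_base that)
  have mult: "integrable M (\<lambda>x. Y x * Z x)"
    if "Y \<in> linear_combinations X T" "Z \<in> linear_combinations X T" for Y Z
    by (rule gaussian_space_integrable_mult[OF H that])
  have linL: "linear_family L" unfolding L_def by (rule linear_family_linear_combinations)
  have linN: "linear_family N"
    unfolding linear_family_def
  proof (intro conjI ballI allI)
    show "(\<lambda>_. 0) \<in> N"
      using linear_family_zero[OF linear_family_linear_combinations[of X T]] by (simp add: N_def)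
    fix Y Y' and t :: real assume Y: "Y \<in> N" and Y': "Y' \<in> N"
    have "expectation (\<lambda>x. (Y x + t * Y' x) * Z x) = 0" if Z: "Z \<in> L" for Z
    proof -
      have "expectation (\<lambda>x. (Y x + t * Y' x) * Z x) = expectation (\<lambda>x. Y x * Z x + t * (Y' x * Z x))"
        by (simp add: algebra_simps)
      also have "\<dots> = 0"
        using mult[of Y Z] mult[of Y' Z] Y Y' Z LT by (auto simp: N_def)
      finally show ?thesis .
    qed
    then show "(\<lambda>x. Y x + t * Y' x) \<in> N"
      using linear_family_add[OF linear_family_linear_combinations, of Y X T Y' t] Y Y' by (simp add: N_def)
  qed
  have saN: "subalgebra M ?N" and saG: "subalgebra M ?G"
    using LT NT meas by (auto intro!: subalgebra_sigma_of_process)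
  have inG: "sets (sigma_of_process M X S) \<subseteq> sets ?G" if "S \<subseteq> C \<union> K" for S
  proof (rule sets_sigma_of_process_subset)
    fix s assume "s \<in> S"
    then have "X s \<in> L" using that unfolding L_def by (intro linear_combinations_base) auto
    then show "X s \<in> borel_measurable ?G" by (rule measurable_sigma_of_process[of _ _ "\<lambda>Y. Y"])
  qed (simp_all add: null_sets_subset_sigma_of_process)
  have saK: "subalgebra ?G ?K" using inG[of K] by (simp add: subalgebra_def)
  have indep: "prob (u \<inter> v) = prob u * prob v" if "u \<in> sets ?N" "v \<in> sets ?G" for u v
    using H NT linN LT linL _ that by (rule gaussian_orthogonal_indep) (auto simp: N_def)
  let ?J = "sigma (space M) (sets ?N \<union> sets ?K)"
  have J: "sets ?J = sigma_sets (space M) (sets ?N \<union> sets ?K)" "space ?J = space M"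
    using sets.space_closed[of ?N] sets.space_closed[of ?K] by (auto simp: space_measure_of_conv)
  have NJ: "subalgebra ?J ?N" and KJ: "subalgebra ?J ?K"
    using J by (auto simp: subalgebra_def)
  have "sets (sigma_of_process M X A) \<subseteq> sets ?J"
  proof (rule sets_sigma_of_process_subset)
    show "null_sets M \<subseteq> sets ?J"
      using null_sets_subset_sigma_of_process KJ unfolding subalgebra_def by blast
    fix s assume s: "s \<in> A"
    then obtain Z where Z: "Z \<in> linear_combinations X K"
      and orth: "\<And>u. u \<in> C \<union> K \<Longrightarrow> expectation (\<lambda>x. (X s x - Z x) * X u x) = 0"
      using regression by blast
    have ZT: "Z \<in> linear_combinations X T" using Z linear_combinations_mono[OF sub(3)] by blast
    have XT: "X s \<in> linear_combinations X T" using s sub by (intro linear_combinations_base) auto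
    have "(\<lambda>x. X s x + (-1) * Z x) \<in> linear_combinations X T"
      by (rule linear_family_add[OF linear_family_linear_combinations XT ZT])
    then have YT: "(\<lambda>x. X s x - Z x) \<in> linear_combinations X T" by simp
    have "(\<lambda>x. X s x - Z x) \<in> N"
      unfolding N_def
    proof (intro CollectI conjI ballI YT)
      fix V assume "V \<in> L"
      then obtain I c where I: "finite I" "I \<subseteq> C \<union> K" and V: "V = (\<lambda>x. \<Sum>t\<in>I. c t * X t x)"
        unfolding L_def linear_combinations_def by blast
      have "integrable M (\<lambda>x. (X s x - Z x) * X t x)" if "t \<in> I" for t
        using that I sub by (intro mult YT linear_combinations_base) auto
      then have "expectation (\<lambda>x. \<Sum>t\<in>I. c t * ((X s x - Z x) * X t x)) = (\<Sum>t\<in>I. c t * expectation (\<lambda>x. (X s x - Z x) * X t x))"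
        by (subst Bochner_Integration.integral_sum) auto
      also have "\<dots> = 0" using orth I by (intro sum.neutral) auto
      finally show "expectation (\<lambda>x. (X s x - Z x) * V x) = 0"
        by (simp add: V sum_distrib_left mult.left_commute)
    qed
    then have "(\<lambda>x. X s x - Z x) \<in> borel_measurable ?J"
      by (intro measurable_from_subalg[OF NJ] measurable_sigma_of_process[of _ _ "\<lambda>Y. Y"])
    moreover have "Z \<in> borel_measurable ?J"
    proof (rule measurable_from_subalg[OF KJ])
      obtain I c where I: "finite I" "I \<subseteq> K" and V: "Z = (\<lambda>x. \<Sum>t\<in>I. c t * X t x)"
        using Z unfolding linear_combinations_def by blast
      show "Z \<in> borel_measurable ?K"
        unfolding V using I(2)
        by (intro borel_measurable_sum borel_measurable_times borel_measurable_const measurable_sigma_of_process) auto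
    qed
    ultimately have "(\<lambda>x. (X s x - Z x) + Z x) \<in> borel_measurable ?J" by (rule borel_measurable_add)
    then show "X s \<in> borel_measurable ?J" by simp
  qed (rule J)
  then have "a \<in> sets ?J" using a by blast
  moreover have "k \<in> sets ?J" using k KJ by (auto simp: subalgebra_def)
  ultimately have "a \<inter> k \<in> sigma_sets (space M) (sets ?N \<union> sets ?K)" unfolding J(1)[symmetric] by (rule sets.Int)
  moreover have "b \<in> sets ?G" using inG[of C] b by blast
  ultimately show ?thesis
    by (rule cond_exp_drop_independent[OF saN saG saK, rotated]) (rule indep)
qed

lemma space_germ_field [simp]: "space (germ_field M T X S) = space M"
  unfolding germ_field_def by (rule space_measure_of_conv)

lemma sets_germ_field:
  "sets (germ_field M T X S) = (\<Inter>\<epsilon>\<in>{0<..}. sets (sigma_of_process M X (rel_neighbourhood T S \<epsilon>)))"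
  (is "_ = ?I")
proof -
  have sub: "?I \<subseteq> sets (sigma_of_process M X (rel_neighbourhood T S \<epsilon>))" if "0 < \<epsilon>" for \<epsilon>
    using that by blast
  have "?I \<subseteq> Pow (space M)"
    using order_trans[OF sub[of 1] sets.space_closed] by simp
  then have "sets (germ_field M T X S) = sigma_sets (space M) ?I"
    unfolding germ_field_def by (rule sets_measure_of)
  moreover have "sigma_sets (space M) ?I \<subseteq> sets (sigma_of_process M X (rel_neighbourhood T S \<epsilon>))"
    if "0 < \<epsilon>" for \<epsilon>
    using sets.sigma_sets_subset[OF sub[OF that]] by simp
  ultimately show ?thesis by (auto intro: sigma_sets.Basic)
qed

lemma subalgebra_germ_field:
  assumes "\<And>t. t \<in> T \<Longrightarrow> X t \<in> borel_measurable M"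
  shows "subalgebra M (germ_field M T X S)"
proof -
  have "subalgebra M (sigma_of_process M X (rel_neighbourhood T S 1))"
    using assms by (intro subalgebra_sigma_of_process) (auto simp: rel_neighbourhood_def split: if_splits)
  moreover have "sets (germ_field M T X S) \<subseteq> sets (sigma_of_process M X (rel_neighbourhood T S 1))"
    unfolding sets_germ_field by (rule INF_lower) simp
  ultimately show ?thesis unfolding subalgebra_def by simp
qed

section \<open>The bridge\<close>

lemma (in prob_space) W_brownian_bridge_gaussian_space:
  assumes "W_brownian_bridge M W B"
  shows "gaussian_space M (linear_combinations B {0..1})"
proof -
  have g: "gaussian_var M (\<lambda>\<omega>. \<Sum>t\<in>I. c t * B t \<omega>)" if "finite I" "I \<subseteq> {0..1}" for I c
    using assms that unfolding W_brownian_bridge_def gaussian_process_def by blast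
  have mean: "expectation (B t) = 0" if "t \<in> {0..1}" for t
    using assms that unfolding W_brownian_bridge_def by blast
  have gB: "gaussian_var M (B t)" if "t \<in> {0..1}" for t
    using g[of "{t}" "\<lambda>_. 1"] that by simp
  have i: "integrable M (B t)" if t: "t \<in> {0..1}" for t
  proof (rule square_integrable_imp_integrable)
    show "B t \<in> borel_measurable M" using gB[OF t] unfolding gaussian_var_def by (rule conjunct1)
    show "integrable M (\<lambda>x. (B t x)\<^sup>2)" by (rule centered_gaussian_fourier(1)[OF gB[OF t] mean[OF t]])
  qed
  show ?thesis
    unfolding gaussian_space_def
  proof (intro conjI ballI linear_family_linear_combinations)
    fix Y assume "Y \<in> linear_combinations B {0..1}"
    then obtain I c where I: "finite I" "I \<subseteq> {0..1}" and Y: "Y = (\<lambda>\<omega>. \<Sum>t\<in>I. c t * B t \<omega>)"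
      unfolding linear_combinations_def by blast
    show "gaussian_var M Y" unfolding Y using I by (rule g)
    have "expectation Y = (\<Sum>t\<in>I. c t * expectation (B t))"
      unfolding Y using I i by (subst Bochner_Integration.integral_sum) auto
    also have "\<dots> = 0" using I mean by (intro sum.neutral) auto
    finally show "expectation Y = 0" .
  qed
qed

lemma W_brownian_bridge_second_moment:
  assumes "W_brownian_bridge M W B" "t \<in> {0..1}" "s \<in> {0..1}"
  shows "(\<integral>\<omega>. B t \<omega> * B s \<omega> \<partial>M) = W (min t s) - W t * W s / W 1"
proof -
  have mean: "(\<integral>\<omega>. B r \<omega> \<partial>M) = 0" if "r \<in> {0..1}" for r
    using assms(1) that unfolding W_brownian_bridge_def by (elim conjE) (rule bspec)
  have "covariance M (B t) (B s) = W (min t s) - W t * W s / W 1"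
  proof -
    have "\<forall>t\<in>{0..1}. \<forall>s\<in>{0..1}. covariance M (B t) (B s) = W (min t s) - W t * W s / W 1"
      using assms(1) unfolding W_brownian_bridge_def by (elim conjE)
    from bspec[OF this assms(2)] assms(3) show ?thesis by (rule bspec)
  qed
  then show ?thesis unfolding covariance_def mean[OF assms(2)] mean[OF assms(3)] by (simp only: diff_zero)
qed

text \<open>
  For fixed \<open>u\<close> the covariance of \<open>B s\<close> and \<open>B u\<close> is an affine function of \<open>W s\<close> on
  \<open>s \<ge> u\<close> and on \<open>s \<le> u\<close>.  Interpolating \<open>W s\<close> linearly between the values at the neighbours
  \<open>p < s < q\<close> of \<open>s\<close> in \<open>K\<close> is therefore exact for all \<open>u\<close> outside of \<open>(p, q)\<close>, and the
  separation hypothesis puts every \<open>u \<in> C\<close> there.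
\<close>

lemma (in prob_space) W_brownian_bridge_regression:
  assumes B: "W_brownian_bridge M W B" and W: "strict_mono W"
    and K: "closed K" "K \<subseteq> {0..1}" "0 \<in> K" "1 \<in> K"
    and s: "s \<in> {0..1}" and C: "C \<subseteq> {0..1}"
    and sep: "\<And>u. u \<in> C \<Longrightarrow> \<exists>k\<in>K. min s u \<le> k \<and> k \<le> max s u"
  shows "\<exists>Z\<in>linear_combinations B K. \<forall>u\<in>C \<union> K. expectation (\<lambda>x. (B s x - Z x) * B u x) = 0"
proof (cases "s \<in> K")
  case True
  then show ?thesis by (intro bexI[of _ "B s"] linear_combinations_base) auto
next
  case False
  have "compact (K \<inter> {0..s})" "compact (K \<inter> {s..1})"
    using K(1) by (auto intro: closed_Int_compact)
  moreover have "K \<inter> {0..s} \<noteq> {}" "K \<inter> {s..1} \<noteq> {}" using K(3,4) s by auto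
  ultimately obtain p q where p: "p \<in> K \<inter> {0..s}" "\<forall>k\<in>K \<inter> {0..s}. k \<le> p"
    and q: "q \<in> K \<inter> {s..1}" "\<forall>k\<in>K \<inter> {s..1}. q \<le> k"
    by (metis compact_attains_sup compact_attains_inf)
  have "p < s" "s < q" using p(1) q(1) False by (auto simp: less_le)
  then have Wpq: "W p < W q" using W by (auto simp: strict_mono_def)
  define \<alpha> where "\<alpha> = (W q - W s) / (W q - W p)"
  define \<beta> where "\<beta> = (W s - W p) / (W q - W p)"
  have sum1: "\<alpha> + \<beta> = 1" using Wpq by (simp add: \<alpha>_def \<beta>_def add_divide_distrib[symmetric])
  have interp: "\<alpha> * W p + \<beta> * W q = W s"
  proof -
    have "\<alpha> * W p + \<beta> * W q = (W s * (W q - W p)) / (W q - W p)"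
      by (simp add: \<alpha>_def \<beta>_def add_divide_distrib[symmetric] algebra_simps)
    then show ?thesis using Wpq by simp
  qed
  define Z where "Z = (\<lambda>x. \<alpha> * B p x + \<beta> * B q x)"
  have lin: "linear_family (linear_combinations B K)" by (rule linear_family_linear_combinations)
  have "B p \<in> linear_combinations B K" "B q \<in> linear_combinations B K"
    using p(1) q(1) by (auto intro!: linear_combinations_base)
  then have "Z \<in> linear_combinations B K"
    using linear_family_add[OF lin linear_family_add[OF lin linear_family_zero[OF lin], of "B p" \<alpha>], of "B q" \<beta>]
    by (simp add: Z_def)
  moreover have "expectation (\<lambda>x. (B s x - Z x) * B u x) = 0" if u: "u \<in> C \<union> K" for u
  proof -
    have u01: "u \<in> {0..1}" using u C K by auto
    have far: "u \<le> p \<or> q \<le> u"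
    proof -
      obtain k where k: "k \<in> K" "min s u \<le> k" "k \<le> max s u"
      proof (cases "u \<in> K")
        case True
        then show ?thesis by (intro that[of u]) auto
      next
        case False
        with u have "u \<in> C" by simp
        then show ?thesis using sep that by blast
      qed
      have "k \<noteq> s" using k(1) \<open>s \<notin> K\<close> by blast
      then consider "k < s" | "s < k" by linarith
      then show ?thesis
      proof cases
        case 1
        then have "u \<le> k" using k(2) by (simp add: min_def split: if_splits)
        moreover have "k \<le> p" using 1 k(1) K(2) by (intro bspec[OF p(2)]) auto
        ultimately show ?thesis by simp
      next
        case 2
        then have "k \<le> u" using k(3) by (simp add: max_def split: if_splits)
        moreover have "q \<le> k" using 2 k(1) K(2) by (intro bspec[OF q(2)]) auto
        ultimately show ?thesis by simp
      qed
    qed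
    define w where "w = W u / W 1"
    have m: "expectation (\<lambda>x. B t x * B u x) = W (min t u) - W t * w" if "t \<in> {0..1}" for t
      using W_brownian_bridge_second_moment[OF B that u01] by (simp add: w_def)
    have i: "integrable M (\<lambda>x. B t x * B u x)" if "t \<in> {0..1}" for t
      using that u01 by (intro gaussian_space_integrable_mult[OF W_brownian_bridge_gaussian_space[OF B]] linear_combinations_base)
    have p01: "p \<in> {0..1}" and q01: "q \<in> {0..1}" using p q K by auto
    have "expectation (\<lambda>x. (B s x - Z x) * B u x)
        = expectation (\<lambda>x. B s x * B u x - (\<alpha> * (B p x * B u x) + \<beta> * (B q x * B u x)))"
      by (simp add: Z_def algebra_simps)
    also have "\<dots> = (W (min s u) - W s * w)
        - (\<alpha> * (W (min p u) - W p * w) + \<beta> * (W (min q u) - W q * w))"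
      using i[OF s] i[OF p01] i[OF q01] m[OF s] m[OF p01] m[OF q01] by simp
    also have "\<dots> = (W (min s u) - (\<alpha> * W (min p u) + \<beta> * W (min q u)))
        - (W s - (\<alpha> * W p + \<beta> * W q)) * w"
      by (simp add: algebra_simps)
    also have "\<dots> = W (min s u) - (\<alpha> * W (min p u) + \<beta> * W (min q u))"
      by (simp add: interp)
    also have "\<dots> = 0"
    proof (cases "u \<le> p")
      case True
      then have "min s u = u" "min p u = u" "min q u = u" using \<open>p < s\<close> \<open>s < q\<close> by auto
      then show ?thesis using sum1 by (simp add: distrib_right[symmetric])
    next
      case False
      then have "min s u = s" "min p u = p" "min q u = q" using far \<open>p < s\<close> \<open>s < q\<close> by auto
      then show ?thesis using interp by simp
    qed
    finally show ?thesis .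
  qed
  ultimately show ?thesis by blast
qed

text \<open>
  Since the \<open>\<sigma>\<close>-algebras contain the null sets, variables that vanish almost surely generate
  nothing new.  This allows the endpoints \<open>0\<close> and \<open>1\<close> of the bridge to be adjoined to any index
  set.
\<close>

lemma sigma_of_process_Un_AE_zero:
  assumes X: "\<And>t. t \<in> K \<union> E \<Longrightarrow> X t \<in> borel_measurable M"
    and zero: "\<And>t. t \<in> E \<Longrightarrow> AE x in M. X t x = 0"
  shows "sets (sigma_of_process M X (K \<union> E)) = sets (sigma_of_process M X K)"
proof
  show "sets (sigma_of_process M X K) \<subseteq> sets (sigma_of_process M X (K \<union> E))"
    by (rule sigma_of_process_mono) simp
  let ?F = "sigma_of_process M X K"
  show "sets (sigma_of_process M X (K \<union> E)) \<subseteq> sets ?F"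
  proof (rule sets_sigma_of_process_subset)
    show "null_sets M \<subseteq> sets ?F" by (rule null_sets_subset_sigma_of_process)
    fix t assume t: "t \<in> K \<union> E"
    show "X t \<in> borel_measurable ?F"
    proof (cases "t \<in> K")
      case True
      then show ?thesis by (rule measurable_sigma_of_process)
    next
      case False
      with t have tE: "t \<in> E" by simp
      have Xt [measurable]: "X t \<in> borel_measurable M" using X t by blast
      have null: "{x \<in> space M. X t x \<noteq> 0} \<in> null_sets M"
      proof (subst AE_iff_null_sets)
        show "AE x in M. x \<notin> {x \<in> space M. X t x \<noteq> 0}"
          using zero[OF tE] by eventually_elim simp
      qed measurable
      have small: "X t -` A \<inter> space M \<in> null_sets M" if "A \<in> sets borel" "0 \<notin> A" for A
        by (rule null_sets_subset[OF null]) (use that measurable_sets[OF Xt that(1)] in auto)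
      show ?thesis
      proof (rule measurableI)
        fix A :: "real set" assume A: "A \<in> sets borel"
        show "X t -` A \<inter> space ?F \<in> sets ?F"
        proof (cases "0 \<in> A")
          case False
          then show ?thesis using small[OF A] null_sets_subset_sigma_of_process by auto
        next
          case True
          then have "X t -` (- A) \<inter> space M \<in> null_sets M" using A by (intro small) auto
          then have "X t -` (- A) \<inter> space M \<in> sets ?F" using null_sets_subset_sigma_of_process by auto
          then have "space ?F - (X t -` (- A) \<inter> space M) \<in> sets ?F" by (rule sets.compl_sets)
          moreover have "space ?F - (X t -` (- A) \<inter> space M) = X t -` A \<inter> space ?F" by auto
          ultimately show ?thesis by simp
        qed
      qed auto
    qed
  qed simp
qed

lemma (in prob_space) W_brownian_bridge_endpoints:
  assumes B: "W_brownian_bridge M W B" and W: "strict_mono W" "W 0 = 0" and t: "t \<in> {0, 1}"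
  shows "AE x in M. B t x = 0"
proof -
  have t01: "t \<in> {0..1}" using t by auto
  have "0 < W 1" using strict_monoD[OF W(1), of 0 1] W(2) by simp
  then have "expectation (\<lambda>x. B t x * B t x) = 0"
    using W_brownian_bridge_second_moment[OF B t01 t01] W t by auto
  moreover have "integrable M (\<lambda>x. B t x * B t x)"
    using t01 by (intro gaussian_space_integrable_mult[OF W_brownian_bridge_gaussian_space[OF B]] linear_combinations_base)
  ultimately have "AE x in M. B t x * B t x = 0"
    by (subst (asm) integral_nonneg_eq_0_iff_AE) auto
  then show ?thesis by simp
qed

lemma frontier_of_crossing:
  fixes x y :: real
  assumes T: "{min x y..max x y} \<subseteq> T" and "x \<in> S" "y \<notin> S"
  shows "\<exists>z\<in>top_of_set T frontier_of S. min x y \<le> z \<and> z \<le> max x y"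
proof -
  have "connectedin (top_of_set T) {min x y..max x y}"
    using T by (simp add: connectedin_subtopology connectedin_iff_connected)
  then have "{min x y..max x y} \<inter> top_of_set T frontier_of S \<noteq> {}"
  proof (rule connectedin_Int_frontier_of)
    have "x \<in> {min x y..max x y}" "y \<in> {min x y..max x y}" by simp_all
    then show "{min x y..max x y} \<inter> S \<noteq> {}" "{min x y..max x y} - S \<noteq> {}"
      using assms by blast+
  qed
  then show ?thesis by auto
qed

lemma rel_neighbourhoodE:
  assumes "t \<in> rel_neighbourhood T S \<epsilon>"
  obtains p where "t \<in> T" "p \<in> S" "dist t p < \<epsilon>"
proof -
  have S: "S \<noteq> {}" "t \<in> T" "infdist t S < \<epsilon>"
    using assms by (auto simp: rel_neighbourhood_def split: if_splits)
  then have "(INF a\<in>S. dist t a) < \<epsilon>" by (simp add: infdist_def)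
  then obtain p where "p \<in> S" "dist t p < \<epsilon>"
    using S(1) by (subst (asm) cINF_less_iff) auto
  with S that show ?thesis by blast
qed

text \<open>
  The conditioning \<open>\<sigma>\<close>-algebras are those of the closed neighbourhoods \<open>K0 n\<close> of the boundary:
  they have the same intersection as those of the open neighbourhoods, but a point outside of a
  closed set that contains \<open>0\<close> and \<open>1\<close> has nearest neighbours in it on both sides.
  A point of a neighbourhood of the closure that is not in \<open>S\<close> is itself close to the boundary,
  and so is a point of \<open>S\<close> close to the complement; so \<open>K0 n\<close> separates the two neighbourhoods.
\<close>

lemma (in prob_space) W_brownian_bridge_cond_indep:
  assumes W: "strict_mono W" "W 0 = 0" and bridge: "W_brownian_bridge M W B"
    and S: "openin (top_of_set {0..1}) S"
  defines "fr \<equiv> top_of_set {0..1} frontier_of S" and "cl \<equiv> top_of_set {0..1} closure_of S"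
  shows "cond_indep M (germ_field M {0..1} B cl) (germ_field M {0..1} B ({0..1} - S))
    (germ_field M {0..1} B fr)"
proof -
  let ?T = "{0..1::real}"
  have gs: "gaussian_space M (linear_combinations B ?T)"
    by (rule W_brownian_bridge_gaussian_space[OF bridge])
  have BM: "B t \<in> borel_measurable M" if "t \<in> ?T" for t
    using gs linear_combinations_base[OF that, of B] by (auto simp: gaussian_space_def gaussian_var_def)
  have ST: "S \<subseteq> ?T" using openin_subset[OF S] by simp
  have clT: "cl \<subseteq> ?T" unfolding cl_def using closure_of_subset_topspace[of "top_of_set ?T" S] by simp
  have frcl: "cl - S = fr"
    unfolding fr_def cl_def frontier_of_def using S by (simp add: interior_of_openin)
  have cross: "\<exists>z\<in>fr. min x y \<le> z \<and> z \<le> max x y" if "x \<in> S" "y \<notin> S" "y \<in> ?T" for x y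
    unfolding fr_def
  proof (intro frontier_of_crossing that)
    have "x \<in> ?T" using that ST by blast
    with that(3) show "{min x y..max x y} \<subseteq> ?T" by (auto simp: min_def max_def split: if_splits)
  qed
  define K0 where "K0 = (\<lambda>n. if fr = {} then {} else {t \<in> ?T. infdist t fr \<le> 1 / real (Suc n)})"
  \<comment> \<open>Adjoining the endpoints gives every point of the interval a neighbour on both sides, also
    when the boundary of \<open>S\<close> is empty or lies on one side only.\<close>
  define K where "K = (\<lambda>n. K0 n \<union> {0, 1})"
  define G where "G = (\<lambda>n. sigma_of_process M B (K n))"
  have K0T: "K0 n \<subseteq> ?T" for n by (auto simp: K0_def)
  have KT: "K n \<subseteq> ?T" for n using K0T by (auto simp: K_def)
  have closedK: "closed (K n)" for n
  proof -
    have "closed {t. infdist t fr \<le> 1 / real (Suc n)}"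
      by (intro closed_Collect_le continuous_intros)
    then have "closed (?T \<inter> {t. infdist t fr \<le> 1 / real (Suc n)})" by (intro closed_Int) auto
    moreover have "?T \<inter> {t. infdist t fr \<le> 1 / real (Suc n)} = {t \<in> ?T. infdist t fr \<le> 1 / real (Suc n)}"
      by blast
    ultimately have "closed (K0 n)" by (simp add: K0_def)
    then show ?thesis unfolding K_def by (intro closed_Un) (simp_all add: finite_imp_closed)
  qed
  have setsG: "sets (G n) = sets (sigma_of_process M B (K0 n))" for n
    unfolding G_def K_def using K0T[of n] W_brownian_bridge_endpoints[OF bridge W] BM
    by (intro sigma_of_process_Un_AE_zero) auto
  have near: "t \<in> K0 n" if "t \<in> ?T" "z \<in> fr" "dist t z < 1 / real (Suc n)" for t z n
    using that infdist_le[of z fr t] by (auto simp: K0_def)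
  have sep: "\<exists>k\<in>K n. min s u \<le> k \<and> k \<le> max s u"
    if s: "s \<in> rel_neighbourhood ?T cl (1 / real (Suc n))"
      and u: "u \<in> rel_neighbourhood ?T (?T - S) (1 / real (Suc n))" for n s u
  proof -
    have "s \<in> K0 n \<or> s \<in> S"
    proof (rule disjCI)
      assume sS: "s \<notin> S"
      obtain p where p: "s \<in> ?T" "p \<in> cl" "dist s p < 1 / real (Suc n)"
        using s by (rule rel_neighbourhoodE)
      show "s \<in> K0 n"
      proof (cases "p \<in> S")
        case True
        obtain z where z: "z \<in> fr" "min p s \<le> z" "z \<le> max p s" using cross[OF True sS p(1)] by blast
        then have "dist s z \<le> dist s p" by (auto simp: dist_real_def)
        with p z show ?thesis by (intro near[of s z]) auto
      next
        case False
        with p frcl show ?thesis by (intro near[of s p]) auto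
      qed
    qed
    moreover have "u \<in> K0 n \<or> u \<notin> S"
    proof (rule disjCI)
      assume uS: "\<not> u \<notin> S"
      obtain p where p: "u \<in> ?T" "p \<in> ?T - S" "dist u p < 1 / real (Suc n)"
        using u by (rule rel_neighbourhoodE)
      obtain z where z: "z \<in> fr" "min u p \<le> z" "z \<le> max u p" using cross[of u p] uS p by blast
      then have "dist u z \<le> dist u p" by (auto simp: dist_real_def)
      with p z show "u \<in> K0 n" by (intro near[of u z]) auto
    qed
    moreover have "u \<in> ?T" using u by (rule rel_neighbourhoodE)
    ultimately consider "s \<in> K0 n" | "u \<in> K0 n" | "s \<in> S" "u \<notin> S" "u \<in> ?T" by blast
    then show ?thesis
    proof cases
      case 1
      then show ?thesis by (intro bexI[of _ s]) (simp_all add: K_def)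
    next
      case 2
      then show ?thesis by (intro bexI[of _ u]) (simp_all add: K_def)
    next
      case 3
      then obtain z where z: "z \<in> fr" "min s u \<le> z" "z \<le> max s u" using cross by blast
      have "z \<in> ?T" using z(1) clT frcl by blast
      then have "z \<in> K0 n" using near[of z z] z(1) by simp
      with z show ?thesis by (intro bexI[of _ z]) (simp_all add: K_def)
    qed
  qed
  have setsH: "sets (germ_field M ?T B fr) = (\<Inter>n. sets (G n))"
  proof (intro equalityI subsetI INT_I)
    fix x n assume x: "x \<in> sets (germ_field M ?T B fr)"
    have "rel_neighbourhood ?T fr (1 / real (Suc n)) \<subseteq> K0 n"
      by (auto simp: rel_neighbourhood_def K0_def)
    moreover have "x \<in> sets (sigma_of_process M B (rel_neighbourhood ?T fr (1 / real (Suc n))))"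
      using x unfolding sets_germ_field by (rule INT_E) auto
    ultimately show "x \<in> sets (G n)" using sigma_of_process_mono setsG by blast
  next
    fix x assume x: "x \<in> (\<Inter>n. sets (G n))"
    show "x \<in> sets (germ_field M ?T B fr)"
      unfolding sets_germ_field
    proof (rule INT_I)
      fix \<epsilon> :: real assume "\<epsilon> \<in> {0<..}"
      then obtain n where n: "1 / real (Suc n) < \<epsilon>" using nat_approx_posE by auto
      then have "K0 n \<subseteq> rel_neighbourhood ?T fr \<epsilon>"
        by (auto simp: rel_neighbourhood_def K0_def)
      moreover have "x \<in> sets (sigma_of_process M B (K0 n))" using x setsG by blast
      ultimately show "x \<in> sets (sigma_of_process M B (rel_neighbourhood ?T fr \<epsilon>))"
        using sigma_of_process_mono by blast
    qed
  qed
  have saG: "subalgebra M (G n)" for n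
    unfolding G_def using KT[of n] BM by (intro subalgebra_sigma_of_process) auto
  show ?thesis
  proof (rule cond_indep_decreasing[of _ _ G])
    show "sets (G m) \<subseteq> sets (G n)" if "n \<le> m" for n m
    proof -
      have "1 / real (Suc m) \<le> 1 / real (Suc n)" using that by (simp add: field_simps)
      then have "K n \<supseteq> K m" by (auto simp: K_def K0_def)
      then show ?thesis unfolding G_def by (rule sigma_of_process_mono)
    qed
    fix n a b k
    assume a: "a \<in> sets (germ_field M ?T B cl)" and b: "b \<in> sets (germ_field M ?T B (?T - S))"
      and k: "k \<in> sets (germ_field M ?T B fr)"
    let ?A = "rel_neighbourhood ?T cl (1 / real (Suc n))"
    let ?C = "rel_neighbourhood ?T (?T - S) (1 / real (Suc n))"
    have AT: "?A \<subseteq> ?T" and CT: "?C \<subseteq> ?T" by (auto simp: rel_neighbourhood_def)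
    have a': "a \<in> sets (sigma_of_process M B ?A)"
      using a unfolding sets_germ_field by (rule INT_E) auto
    have b': "b \<in> sets (sigma_of_process M B ?C)"
      using b unfolding sets_germ_field by (rule INT_E) auto
    have k': "k \<in> sets (sigma_of_process M B (K n))"
      using k unfolding setsH G_def by blast
    show "(LINT x:(a \<inter> k)|M. indicator b x) = (LINT x:(a \<inter> k)|M. real_cond_exp M (G n) (indicator b) x)"
      unfolding G_def
    proof (rule gaussian_separation[OF gs AT CT KT _ a' k' b'])
      fix s assume s: "s \<in> ?A"
      show "\<exists>Z\<in>linear_combinations B (K n). \<forall>u\<in>?C \<union> K n. expectation (\<lambda>x. (B s x - Z x) * B u x) = 0"
      proof (rule W_brownian_bridge_regression[OF bridge W(1) closedK KT _ _ _ CT])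
        show "0 \<in> K n" "1 \<in> K n" by (simp_all add: K_def)
        show "s \<in> ?T" using s AT by blast
        show "\<exists>k\<in>K n. min s u \<le> k \<and> k \<le> max s u" if "u \<in> ?C" for u
          by (rule sep[OF s that])
      qed
    qed
  qed (use saG setsH BM in \<open>auto intro!: subalgebra_germ_field\<close>)
qed

theorem proposition17:
  fixes M :: "'a measure" and W :: "real \<Rightarrow> real" and B :: "real \<Rightarrow> 'a \<Rightarrow> real"
  assumes "prob_space M"
    and "strict_mono W"
    and "cadlag W"
    and "\<And>x. W (x + 1) - W x = W 1 - W 0"
    and "isCont W 0"
    and "W 0 = 0"
    and "W_brownian_bridge M W B"
  shows "gaussian_markov_random_field M {0..1} B"
  unfolding gaussian_markov_random_field_def markov_random_field_def
proof (intro conjI allI impI)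
  show "gaussian_process M {0..1} B"
    using assms(7) by (simp add: W_brownian_bridge_def)
  fix S :: "real set" assume "openin (top_of_set {0..1}) S"
  then show "cond_indep M
      (germ_field M {0..1} B (top_of_set {0..1} closure_of S))
      (germ_field M {0..1} B ({0..1} - S))
      (germ_field M {0..1} B (top_of_set {0..1} frontier_of S))"
    by (rule prob_space.W_brownian_bridge_cond_indep[OF assms(1,2,6,7)])
qed

end
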